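(* Let $n \ge 1$, let $0 < p_1 < p_2 < \cdots < p_n$ be real numbers, and let $r$ be a positive real number. Let $L_r$ be the $n \times n$ real symmetric matrix $$L_r = \left[ \frac{p_i^r - p_j^r}{p_i - p_j} \right]_{i,j=1}^n ,$$ where the diagonal entries ($i=j$) are understood to be $r p_i^{r-1}$. Then the following hold. (i) $L_r$ is singular if and only if $r \in \{1, 2, \ldots, n-1\}$. (ii) If $r \in \{1, 2, \ldots, n\}$, then the inertia of $L_r$ is given as follows: if $r = 2k$ for an integer $k$, then $\mathrm{In}(L_r) = (k, n-r, k)$; if $r = 2k-1$ for an integer $k$, then $\mathrm{In}(L_r) = (k, n-r, k-1)$. (iii) If $0 < r < n$ and $r$ is not an integer, then: if $\lfloor r \rfloor = 2k$ for an integer $k$, then $\mathrm{In}(L_r) = (n-k, 0, k)$; if $\lfloor r \rfloor = 2k-1$ for an integer $k$, then $\mathrm{In}(L_r) = (k, 0, n-k)$. (iv) If $r > n-1$, then $\mathrm{In}(L_r) = \mathrm{In}(L_n)$, where $L_n$ is the matrix obtained by taking exponent $n$ in place of $r$ with the same points $p_1, \ldots, p_n$. (v) Every nonzero eigenvalue of $L_r$ is simple.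
   Context: For an $n \times n$ Hermitian matrix $A$, the inertia of $A$ is the triple $\mathrm{In}(A) = (\pi(A), \zeta(A), \nu(A))$, where $\pi(A)$, $\zeta(A)$ and $\nu(A)$ are the numbers of positive, zero and negative eigenvalues of $A$ respectively, counted with multiplicity. The diagonal entries of $L_r$ are the limiting values of the difference quotient, i.e. the derivative of $t \mapsto t^r$ at $p_i$. $\lfloor r \rfloor$ denotes the greatest integer not exceeding $r$. *)

theory Defs
  imports "Jordan_Normal_Form.Char_Poly"
begin

definition eig_mult :: "'a::field mat \<Rightarrow> 'a \<Rightarrow> nat" where
  "eig_mult A x = Polynomial.order x (char_poly A)"

(* Meant for Hermitian matrices: all eigenvalues are then real, and algebraic and geometric
   multiplicity agree. The class real_field admits both complex Hermitian and real symmetric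
   matrices. For square A the index sets of the sums are finite. *)
definition inertia :: "'a::real_field mat \<Rightarrow> nat \<times> nat \<times> nat" where
  "inertia A =
    (\<Sum>x\<in>{x::real. 0 < x \<and> eigenvalue A (of_real x)}. eig_mult A (of_real x),
     eig_mult A 0,
     \<Sum>x\<in>{x::real. x < 0 \<and> eigenvalue A (of_real x)}. eig_mult A (of_real x))"

(* The points are indexed from 0, following the library's matrices: p i stands for p_(i+1).
   The diagonal entry is the derivative of the map t |-> t powr r at p i. *)
definition loewner_powr :: "nat \<Rightarrow> (nat \<Rightarrow> real) \<Rightarrow> real \<Rightarrow> real mat" where
  "loewner_powr n p r = mat n n (\<lambda>(i, j).
     if i = j then r * p i powr (r - 1)
     else (p i powr r - p j powr r) / (p i - p j))"

end

theory Submission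
  imports Defs
begin

text \<open>
  Let \<open>K\<close> be the kernel of difference quotients of the map sending \<open>t\<close> to \<open>t powr r\<close>, so that the matrix
  consists of the values of \<open>K\<close> at pairs of the given points. Three ideas carry the proof.

  Zero counting (\<open>loewner_combination_zero\<close>). A combination of \<open>k\<close> functions \<open>K t y\<close> of \<open>t\<close>, multiplied by the
  product of the \<open>t - y\<close>, is a sum of \<open>2 * k\<close> real powers of \<open>t\<close>. The exponents are distinct unless \<open>r\<close> is
  an integer with \<open>\<bar>r\<bar> < k\<close>, and then Rolle's theorem allows fewer than \<open>2 * k\<close> positive zeros. As \<open>k\<close> of them
  are the points \<open>y\<close>, a nontrivial combination itself has fewer than \<open>k\<close> zeros. So the matrix of size
  \<open>n\<close> is nonsingular unless \<open>r\<close> is one of the integers \<open>1, \<dots>, n - 1\<close>. Moreover, while \<open>r\<close> moves without crossing such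
  an integer, no leading principal minor changes sign, hence the inertia is constant
  (\<open>card_negative_constant\<close>). This settles all exponents greater than \<open>n - 1\<close> once the exponent \<open>n\<close> is known.

  Lowering the exponent (\<open>loewner_kernel_shift\<close>). The kernels for \<open>r\<close> and for \<open>r - 2\<close> differ by the factor
  \<open>x * y\<close> and by two terms that depend on one variable only. On the vectors whose first \<open>k\<close> moments vanish,
  the quadratic form for \<open>r\<close> is therefore congruent to the form for \<open>r - 2 * k\<close>. For exponents in \<open>{0..1}\<close> that
  form is nonnegative, which is Loewner's theorem: it holds for the exponent 1/2, where a Cauchy matrix arises,
  and spreads by constancy of the inertia. For exponents in \<open>{- 1..0}\<close> the form is nonpositive. So there are at
  most \<open>k\<close> negative eigenvalues for \<open>r\<close> between \<open>2 * k\<close> and \<open>2 * k + 1\<close>, and at most \<open>k\<close> positive ones for \<open>r\<close>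
  between \<open>2 * k - 1\<close> and \<open>2 * k\<close>. The matching lower bounds come by interlacing from the principal
  submatrix whose size \<open>m\<close> is the integer part of \<open>r\<close>: it has the same inertia as for exponent \<open>m\<close>, where it
  is nonsingular and the two upper bounds add up to its size, so that both are attained.

  Sign changes (\<open>variation_diminishing\<close>, \<open>eigenvector_first_component_nonzero\<close>). An eigenvector \<open>c\<close> for a
  nonzero eigenvalue gives a combination \<open>f\<close> of the functions \<open>K t y\<close> whose values at the points are proportional
  to \<open>c\<close>, so between the points \<open>f\<close> has at least as many zeros as \<open>c\<close> has sign changes. By duality and zero
  counting it cannot have one zero more. Hence \<open>c\<close> cannot vanish at the first point; but in an eigenspace of
  dimension two some nonzero vector does.
\<close>

section \<open>Zeros of sums of real powers\<close>

text \<open>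
  Rolle's theorem between consecutive zeros. The new zeros lie strictly between old ones, so they can
  be counted in addition to any double zeros of \<open>g\<close>; the bound by \<open>Max Z\<close> only serves the induction,
  where a new largest zero is added.
\<close>
lemma rolle_zero_set:
  fixes g g' :: "real \<Rightarrow> real"
  assumes deriv: "\<And>t. 0 < t \<Longrightarrow> (g has_real_derivative g' t) (at t)"
    and "finite Z" "Z \<noteq> {}" "\<And>z. z \<in> Z \<Longrightarrow> 0 < z \<and> g z = 0"
  shows "\<exists>R. finite R \<and> card Z = Suc (card R) \<and> R \<inter> Z = {} \<and> (\<forall>x\<in>R. 0 < x \<and> x < Max Z \<and> g' x = 0)"
  using assms(2-4)
proof (induction Z rule: finite_linorder_max_induct)
  case empty
  then show ?case by simp
next
  case (insert b A)
  show ?case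
  proof (cases "A = {}")
    case True
    then show ?thesis by (intro exI[of _ "{}"]) auto
  next
    case False
    then obtain R where R: "finite R" "card A = Suc (card R)" "R \<inter> A = {}"
      "\<forall>x\<in>R. 0 < x \<and> x < Max A \<and> g' x = 0" using insert by auto
    define a where "a = Max A"
    have a: "a \<in> A" "\<And>x. x \<in> A \<Longrightarrow> x \<le> a" using False insert.hyps a_def by auto
    have ab: "a < b" "0 < a" "g a = 0" "g b = 0" using a insert by auto
    have "\<exists>z. a < z \<and> z < b \<and> (g has_real_derivative 0) (at z)"
    proof (rule Rolle)
      show "continuous_on {a..b} g"
        using deriv ab by (auto intro!: continuous_at_imp_continuous_on DERIV_isCont[OF deriv])
      show "g differentiable (at x)" if "a < x" "x < b" for x
        using deriv[of x] that ab real_differentiable_def by auto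
    qed (use ab in auto)
    then obtain z where z: "a < z" "z < b" "(g has_real_derivative 0) (at z)" by blast
    have "g' z = 0" using DERIV_unique[OF z(3) deriv[of z]] z ab by auto
    moreover have "z \<notin> R" "z \<notin> A" "b \<notin> R" "b \<notin> A" using R(4) a z a_def by force+
    moreover have "Max (insert b A) = b" using insert ab a by (auto intro!: Max_eqI) 
    moreover have "x < b" if "x \<in> R" for x
      using R(4) that ab a_def by force
    ultimately show ?thesis using R z ab insert.hyps
      by (intro exI[of _ "insert z R"] conjI ballI) auto
  qed
qed

text \<open>
  A sum of \<open>N\<close> real powers with distinct exponents has fewer than \<open>N\<close> positive zeros, where the points of
  \<open>D\<close> count twice. Dividing by one of the powers makes that summand constant, so the derivative has
  one summand less; by Rolle it loses at most one zero. Double zeros become simple zeros of the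
  derivative, hence the induction hypothesis is applied with an empty set of double zeros.
\<close>
lemma generalized_polynomial_zeros:
  fixes a e :: "'i \<Rightarrow> real"
  assumes "finite I" "inj_on e I" "finite Z" "D \<subseteq> Z" "card I \<le> card Z + card D"
    and "\<And>z. z \<in> Z \<Longrightarrow> 0 < z \<and> (\<Sum>i\<in>I. a i * z powr e i) = 0"
    and "\<And>z. z \<in> D \<Longrightarrow> ((\<lambda>t. \<Sum>i\<in>I. a i * t powr e i) has_real_derivative 0) (at z)"
  shows "\<forall>i\<in>I. a i = 0"
  using assms
proof (induction I arbitrary: a e Z D rule: finite_induct)
  case empty
  then show ?case by simp
next
  case (insert k I)
  define F where "F t = (\<Sum>i\<in>insert k I. a i * t powr e i)" for t
  \<comment> \<open>Dividing by \<open>t powr e k\<close> makes the summand of \<open>k\<close> constant.\<close>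
  define G where "G t = (\<Sum>i\<in>insert k I. a i * t powr (e i - e k))" for t
  define G' where "G' t = (\<Sum>i\<in>I. a i * (e i - e k) * t powr (e i - e k - 1))" for t
  have FG: "F t = t powr e k * G t" if "0 < t" for t
    using that insert.hyps unfolding F_def G_def
    by (simp add: sum_distrib_left powr_diff field_simps)
  have dG: "(G has_real_derivative G' t) (at t)" if "0 < t" for t
  proof -
    have "((\<lambda>t. \<Sum>i\<in>insert k I. a i * t powr (e i - e k)) has_real_derivative
       (\<Sum>i\<in>insert k I. a i * ((e i - e k) * t powr (e i - e k - 1)))) (at t)"
      using that by (intro DERIV_sum) (auto intro!: derivative_eq_intros DERIV_cmult simp: mult.commute)
    then show ?thesis using insert.hyps unfolding G_def[abs_def] G'_def by (simp add: mult.assoc)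
  qed
  have Z: "0 < z" "G z = 0" if "z \<in> Z" for z
    using insert.prems(5)[OF that] FG[of z] F_def by auto
  have D: "G' z = 0" if "z \<in> D" for z
  proof -
    have z: "0 < z" "G z = 0" using that insert.prems(3) Z by auto
    have "(F has_real_derivative 0) (at z)"
      using insert.prems(6)[OF that] F_def[abs_def] by simp
    then have "((\<lambda>t. t powr e k * G t) has_real_derivative 0) (at z)"
      by (rule DERIV_cong_ev[THEN iffD1, rotated -1])
         (use z FG in \<open>auto intro!: eventually_mono[OF eventually_gt_at_top] simp: eventually_nhds intro!: exI[of _ "{0<..}"]\<close>)
    moreover have "((\<lambda>t. t powr e k * G t) has_real_derivative (e k * z powr (e k - 1) * G z + G' z * z powr e k)) (at z)"
      using z dG by (intro DERIV_mult has_real_derivative_powr) auto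
    ultimately show ?thesis using DERIV_unique z by fastforce
  qed
  have "Z \<noteq> {}" using insert by (auto simp: finite_subset)
  obtain R where R: "finite R" "card Z = Suc (card R)" "R \<inter> Z = {}" "\<forall>x\<in>R. 0 < x \<and> G' x = 0"
    using rolle_zero_set[OF dG insert.prems(2) \<open>Z \<noteq> {}\<close>] Z by blast
  have fD: "finite D" using insert.prems finite_subset by blast
  have "\<forall>i\<in>I. a i * (e i - e k) = 0"
  proof (rule insert.IH[of "\<lambda>i. e i - e k - 1" "R \<union> D" "{}"])
    have "card (R \<union> D) = card R + card D"
      using R fD insert.prems(3) by (intro card_Un_disjoint) auto
    then show "card I \<le> card (R \<union> D) + card {}" using R insert.prems insert.hyps by auto
  qed (use insert.prems R D Z fD in \<open>auto simp: G'_def inj_on_def\<close>)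
  then have *: "\<forall>i\<in>I. a i = 0" using insert.prems(1) insert.hyps by (auto simp: inj_on_def)
  obtain z where "z \<in> Z" using \<open>Z \<noteq> {}\<close> by auto
  then have "a k = 0" using insert.prems(5)[of z] insert.hyps * by force
  then show ?case using * by simp
qed

section \<open>Zeros of combinations of the Loewner kernel\<close>

text \<open>
  The Loewner matrix of points \<open>p i\<close> is this kernel evaluated at all pairs. Keeping the kernel
  separate from the matrix allows evaluation at points outside the given set.
\<close>
definition loewner_kernel :: "real \<Rightarrow> real \<Rightarrow> real \<Rightarrow> real" where
  "loewner_kernel r x y =
    (if x = y then r * x powr (r - 1) else (x powr r - y powr r) / (x - y))"

lemma loewner_kernel_commute: "loewner_kernel r x y = loewner_kernel r y x"
  unfolding loewner_kernel_def by (cases "x = y") (auto simp: divide_simps, auto simp: algebra_simps)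

lemma loewner_kernel_mult_diff: "loewner_kernel r x y * (x - y) = x powr r - y powr r"
  unfolding loewner_kernel_def by auto

lemma isCont_loewner_kernel:
  assumes "0 < t" "0 < y" shows "isCont (\<lambda>t. loewner_kernel r t y) t"
proof (cases "t = y")
  case True
  have "((\<lambda>t. t powr r) has_real_derivative r * y powr (r - 1)) (at y)"
    using assms by (rule_tac has_real_derivative_powr) auto
  then have "((\<lambda>t. (t powr r - y powr r) / (t - y)) \<longlongrightarrow> r * y powr (r - 1)) (at y)"
    by (simp add: has_field_derivative_iff)
  then have "((\<lambda>t. loewner_kernel r t y) \<longlongrightarrow> r * y powr (r - 1)) (at y)"
    by (rule Lim_transform_eventually) (auto simp: loewner_kernel_def eventually_at_filter)
  then show ?thesis using True by (simp add: isCont_def loewner_kernel_def)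
next
  case False
  have "isCont (\<lambda>t. (t powr r - y powr r) / (t - y)) t"
    using assms False by (intro continuous_intros) auto
  moreover have "\<forall>\<^sub>F u in nhds t. (u powr r - y powr r) / (u - y) = loewner_kernel r u y"
    using False by (auto simp: eventually_nhds loewner_kernel_def intro!: exI[of _ "- {y}"])
  ultimately show ?thesis using isCont_cong by fast
qed

lemma differentiable_loewner_kernel:
  assumes "0 < t" "t \<noteq> y"
  shows "\<exists>D. ((\<lambda>t. loewner_kernel r t y) has_real_derivative D) (at t)"
proof -
  have "((\<lambda>t. (t powr r - y powr r) / (t - y)) has_real_derivative
      (r * t powr (r - 1) * (t - y) - (t powr r - y powr r)) / ((t - y) * (t - y))) (at t)"
    using assms by (auto intro!: derivative_eq_intros has_real_derivative_powr)
  moreover have "\<forall>\<^sub>F u in nhds t. (u powr r - y powr r) / (u - y) = loewner_kernel r u y"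
    using assms by (auto simp: eventually_nhds loewner_kernel_def intro!: exI[of _ "- {y}"])
  ultimately show ?thesis using DERIV_cong_ev by fast
qed

lemma degree_prod_linear_factors: "finite Y \<Longrightarrow> degree (\<Prod>l\<in>Y. [:- l, 1:] :: real poly) = card Y"
  by (subst degree_prod_eq_sum_degree) auto

text \<open>
  Multiplying \<open>f t = (\<Sum>y\<in>Y. c y * loewner_kernel r t y)\<close> by \<open>\<Prod>l\<in>Y. t - l\<close> clears the denominators and gives
  \<open>t powr r * P t - Q t\<close> with polynomials of degree less than \<open>card Y\<close>. This is a sum of \<open>2 * card Y\<close> real
  powers, with distinct exponents unless \<open>r\<close> is an integer of absolute value below \<open>card Y\<close>. It vanishes on
  \<open>Y\<close> and wherever \<open>f\<close> does, twice on \<open>Z \<inter> Y\<close> and on \<open>D\<close>. If \<open>f\<close> has \<open>card Y\<close> zeros or more, then all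
  coefficients of \<open>P\<close> are zero, and the values of \<open>P\<close> on \<open>Y\<close> are nonzero multiples of the \<open>c y\<close>.
\<close>
lemma loewner_combination_zero:
  fixes c :: "real \<Rightarrow> real"
  assumes Y: "finite Y" "Y \<subseteq> {0<..}" and r: "r \<in> \<int> \<Longrightarrow> real (card Y) \<le> \<bar>r\<bar>"
    and Z: "finite Z" "Z \<subseteq> {0<..}" "\<And>z. z \<in> Z \<Longrightarrow> (\<Sum>y\<in>Y. c y * loewner_kernel r z y) = 0"
    and D: "D \<subseteq> Z - Y"
      "\<And>z. z \<in> D \<Longrightarrow> ((\<lambda>t. \<Sum>y\<in>Y. c y * loewner_kernel r t y) has_real_derivative 0) (at z)"
    and card: "card Y \<le> card Z + card D"
  shows "\<forall>y\<in>Y. c y = 0"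
proof
  fix y0 assume y0: "y0 \<in> Y"
  define k where "k = card Y"
  have kpos: "0 < k" using y0 Y k_def card_gt_0_iff by blast
  define f where "f t = (\<Sum>y\<in>Y. c y * loewner_kernel r t y)" for t
  define W where "W t = (\<Prod>l\<in>Y. t - l)" for t :: real
  define B where "B y = (\<Prod>l\<in>Y - {y}. [:- l, 1:] :: real poly)" for y
  define P where "P = (\<Sum>y\<in>Y. Polynomial.smult (c y) (B y))"
  define Q where "Q = (\<Sum>y\<in>Y. Polynomial.smult (c y * y powr r) (B y))"
  define F where "F t = t powr r * poly P t - poly Q t" for t
  have polyB: "poly (B y) t = (\<Prod>l\<in>Y - {y}. t - l)" for y t
    unfolding B_def poly_prod by simp
  have degB: "degree (B y) < k" if "y \<in> Y" for y
    using that Y(1) kpos k_def unfolding B_def by (subst degree_prod_linear_factors) auto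
  have degP: "degree P < k" and degQ: "degree Q < k"
    unfolding P_def Q_def using kpos Y degB
    by (auto intro!: degree_sum_less le_less_trans[OF degree_smult_le])
  have FW: "F t = W t * f t" for t
  proof -
    have "F t = (\<Sum>y\<in>Y. c y * (t powr r - y powr r) * (\<Prod>l\<in>Y - {y}. t - l))"
      unfolding F_def P_def Q_def by (simp add: poly_sum polyB sum_distrib_left sum_subtractf[symmetric] algebra_simps)
    also have "\<dots> = (\<Sum>y\<in>Y. W t * (c y * loewner_kernel r t y))"
    proof (rule sum.cong[OF refl])
      fix y assume "y \<in> Y"
      then have Wt: "W t = (t - y) * (\<Prod>l\<in>Y - {y}. t - l)"
        unfolding W_def using Y by (simp add: prod.remove)
      show "c y * (t powr r - y powr r) * (\<Prod>l\<in>Y - {y}. t - l) = W t * (c y * loewner_kernel r t y)"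
        unfolding Wt loewner_kernel_mult_diff[symmetric] by (simp only: mult_ac)
    qed
    finally show ?thesis by (simp add: f_def sum_distrib_left)
  qed
  define I where "I = {..<k} <+> {..<k}"
  define a where "a i = (case i of Inl j \<Rightarrow> coeff P j | Inr j \<Rightarrow> - coeff Q j)" for i :: "nat + nat"
  define e where "e i = (case i of Inl j \<Rightarrow> r + real j | Inr j \<Rightarrow> real j)" for i :: "nat + nat"
  have F_sum: "F t = (\<Sum>i\<in>I. a i * t powr e i)" if "0 < t" for t
  proof -
    have pol: "poly p t = (\<Sum>j<k. coeff p j * t ^ j)" if "degree p < k" for p :: "real poly"
      unfolding poly_altdef using that 
      by (intro sum.mono_neutral_left) (auto simp: coeff_eq_0)
    show ?thesis unfolding F_def I_def pol[OF degP] pol[OF degQ] using that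
      by (simp add: sum.Plus a_def e_def powr_add powr_realpow sum_distrib_left sum_negf algebra_simps)
  qed
  have inj: "inj_on e I"
  proof -
    have "r + real j \<noteq> real j'" if "j < k" "j' < k" for j j'
    proof
      assume eq: "r + real j = real j'"
      then have "r = of_int (int j' - int j)" by simp
      then have "r \<in> \<int>" by (metis Ints_of_int)
      from r[OF this] show False using eq that k_def by linarith
    qed
    then have "r + real j \<noteq> real j'" "real j' \<noteq> r + real j" if "j < k" "j' < k" for j j' using that by metis+
    then show ?thesis unfolding inj_on_def I_def e_def by (auto simp: Plus_def)
  qed
  define Z2 where "Z2 = Z \<union> Y"
  define D2 where "D2 = (Z \<inter> Y) \<union> D"
  have fin: "finite Z2" "finite D2" "finite D" using Y Z D unfolding Z2_def D2_def
    by (auto intro: finite_subset)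
  have cardI: "card I \<le> card Z2 + card D2"
  proof -
    have "card D2 = card (Z \<inter> Y) + card D"
      unfolding D2_def using fin Z D by (intro card_Un_disjoint) auto
    moreover have "card Z2 + card (Z \<inter> Y) = card Z + card Y"
      unfolding Z2_def using card_Un_Int[OF Z(1) Y(1)] by simp
    moreover have "card I = 2 * k" by (simp add: I_def card_Plus)
    ultimately show ?thesis using card k_def by linarith
  qed
  have Wd: "\<exists>W'. (W has_real_derivative W') (at z)" for z
  proof -
    have "W = poly (\<Prod>l\<in>Y. [:- l, 1:])" by (auto simp: W_def poly_prod)
    then show ?thesis using poly_DERIV by metis
  qed
  have dF: "(F has_real_derivative 0) (at z)" if "z \<in> D2" for z
  proof (cases "z \<in> Y")
    case True
    then have z: "z \<in> Z" "0 < z" "f z = 0" using that Y D Z f_def by (auto simp: D2_def)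
    \<comment> \<open>At \<open>z \<in> Y\<close> continuity of \<open>f\<close> suffices: \<open>F t\<close> equals \<open>t - z\<close> times a function that is continuous
      at \<open>z\<close> with value 0.\<close>
    show ?thesis unfolding CARAT_DERIV
    proof (intro exI[of _ "\<lambda>t. (\<Prod>l\<in>Y - {z}. t - l) * f t"] conjI allI)
      have Wz: "W t = (t - z) * (\<Prod>l\<in>Y - {z}. t - l)" for t
        unfolding W_def using Y True by (simp add: prod.remove)
      show "F t - F z = (\<Prod>l\<in>Y - {z}. t - l) * f t * (t - z)" for t
        unfolding FW Wz by simp
      show "isCont (\<lambda>t. (\<Prod>l\<in>Y - {z}. t - l) * f t) z"
        unfolding f_def using z Y by (intro continuous_intros isCont_loewner_kernel) auto
    qed (use z in simp)
  next
    case False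
    then have z: "z \<in> D" "f z = 0" using that Z D f_def by (auto simp: D2_def)
    obtain W' where "(W has_real_derivative W') (at z)" using Wd by blast
    moreover have "(f has_real_derivative 0) (at z)" using D(2)[OF z(1)] f_def[abs_def] by simp
    ultimately have "((\<lambda>t. W t * f t) has_real_derivative W' * f z + 0 * W z) (at z)"
      by (rule DERIV_mult)
    then show ?thesis using z FW[abs_def] by simp
  qed
  have "\<forall>i\<in>I. a i = 0"
  proof (rule generalized_polynomial_zeros[OF _ inj fin(1) _ cardI])
    show "finite I" "D2 \<subseteq> Z2" using D by (auto simp: I_def D2_def Z2_def)
    show "0 < z \<and> (\<Sum>i\<in>I. a i * z powr e i) = 0" if "z \<in> Z2" for z
    proof -
      have "W z = 0 \<or> f z = 0" "0 < z" using that Y Z unfolding Z2_def W_def f_def by auto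
      then show ?thesis using FW[of z] F_sum[of z] by auto
    qed
    show "((\<lambda>t. \<Sum>i\<in>I. a i * t powr e i) has_real_derivative 0) (at z)" if "z \<in> D2" for z
    proof -
      have z: "0 < z" using that Y Z D by (auto simp: D2_def)
      have "\<forall>\<^sub>F u in nhds z. F u = (\<Sum>i\<in>I. a i * u powr e i)"
        using z F_sum by (auto simp: eventually_nhds intro!: exI[of _ "{0<..}"])
      then show ?thesis using dF[OF that] DERIV_cong_ev by fast
    qed
  qed
  then have "coeff P j = 0" if "j < k" for j
    using that by (auto simp: I_def a_def dest!: bspec[of _ _ "Inl j"])
  then have "P = 0" using degP by (metis leading_coeff_0_iff)
  moreover have "poly P y0 = c y0 * (\<Prod>l\<in>Y - {y0}. y0 - l)"
  proof -
    have "poly P y0 = (\<Sum>y\<in>Y. if y = y0 then c y0 * (\<Prod>l\<in>Y - {y0}. y0 - l) else 0)"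
      unfolding P_def poly_sum poly_smult polyB
      by (rule sum.cong) (use Y y0 in \<open>auto intro: prod_zero\<close>)
    then show ?thesis using y0 Y by simp
  qed
  ultimately show "c y0 = 0" using Y by auto
qed

section \<open>Sign changes and eigenvectors\<close>

lemma homogeneous_system_nontrivial_solution:
  fixes M :: "'j \<Rightarrow> 'i \<Rightarrow> real"
  assumes "finite J" "finite I" "card J < card I"
  shows "\<exists>c. (\<exists>i\<in>I. c i \<noteq> 0) \<and> (\<forall>j\<in>J. (\<Sum>i\<in>I. M j i * c i) = 0)"
  using assms
proof (induction J arbitrary: I M rule: finite_induct)
  case empty
  then obtain i where "i \<in> I" by fastforce
  then show ?case by (intro exI[of _ "\<lambda>_. 1"]) auto
next
  case (insert k J)
  show ?case
  proof (cases "\<forall>i\<in>I. M k i = 0")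
    case True
    obtain c where "\<exists>i\<in>I. c i \<noteq> 0" "\<forall>j\<in>J. (\<Sum>i\<in>I. M j i * c i) = 0"
      using insert.IH[of I M] insert.prems insert.hyps by auto
    with True show ?thesis by (intro exI[of _ c]) auto
  next
    case False
    then obtain p where p: "p \<in> I" "M k p \<noteq> 0" by auto
    \<comment> \<open>Gaussian elimination of the unknown \<open>p\<close> by means of the equation \<open>k\<close>.\<close>
    define N where "N j i = M j i - M j p * M k i / M k p" for j i
    have "finite (I - {p})" "card J < card (I - {p})"
      using insert.prems insert.hyps p by (simp_all add: card_Diff_singleton)
    from insert.IH[OF this, of N]
    obtain c where c: "\<exists>i\<in>I - {p}. c i \<noteq> 0" "\<forall>j\<in>J. (\<Sum>i\<in>I - {p}. N j i * c i) = 0"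
      by blast
    define s where "s j = (\<Sum>i\<in>I - {p}. M j i * c i)" for j
    define c' where "c' = c(p := - s k / M k p)"
    have sum: "(\<Sum>i\<in>I. M j i * c' i) = s j - M j p * s k / M k p" for j
      using p insert.prems unfolding c'_def s_def by (simp add: sum.remove[of I p])
    have "s j - M j p * s k / M k p = 0" if "j \<in> J" for j
    proof -
      have "s j - M j p * s k / M k p = (\<Sum>i\<in>I - {p}. N j i * c i)"
        unfolding s_def N_def
        by (simp add: sum_distrib_left sum_divide_distrib sum_subtractf[symmetric] algebra_simps)
      then show ?thesis using c(2) that by simp
    qed
    moreover have "\<exists>i\<in>I. c' i \<noteq> 0" using c(1) c'_def by auto
    ultimately show ?thesis using sum p(2) by (intro exI[of _ c']) auto
  qed
qed

lemma nonvanishing_continuous_same_sign: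
  fixes u :: "real \<Rightarrow> real"
  assumes "continuous_on {a..b} u" "\<And>x. x \<in> {a..b} \<Longrightarrow> u x \<noteq> 0" "a \<le> b"
  shows "0 < u a * u b"
proof (rule ccontr)
  assume "\<not> ?thesis"
  moreover have "u a \<noteq> 0" "u b \<noteq> 0" using assms by auto
  ultimately have "u a < 0 \<and> 0 < u b \<or> 0 < u a \<and> u b < 0"
    by (metis mult_neg_neg mult_pos_pos linorder_neqE_linordered_idom)
  then have "\<exists>x\<ge>a. x \<le> b \<and> u x = 0"
    using assms IVT'[of u a 0 b] IVT2'[of u b 0 a] by auto
  then show False using assms by auto
qed

text \<open>
  The function \<open>f t = (\<Sum>y\<in>S. c y * loewner_kernel r t y)\<close> cannot have more zeros than \<open>c\<close> has sign changes. The
  sign changes are encoded by \<open>T\<close>: one point for each place where \<open>c\<close> switches sign, which makes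
  \<open>c y * (\<Prod>\<tau>\<in>T. y - \<tau>)\<close> nonnegative, up to a global factor. The proof is by duality. Some nontrivial combination
  \<open>g\<close> of the functions \<open>loewner_kernel r t x\<close> with \<open>x \<in> X\<close> vanishes on \<open>T\<close>. By zero counting with
  multiplicities, it has no other zeros and these are simple, so \<open>g\<close> changes sign exactly at \<open>T\<close>.
  Hence the terms of \<open>\<Sum>y\<in>S. c y * g y\<close> all have the same sign, while the symmetry of the kernel turns this
  sum into a combination of values of \<open>f\<close> on \<open>X\<close>, which is zero.
\<close>
lemma variation_diminishing:
  fixes c :: "real \<Rightarrow> real"
  assumes X: "finite X" "X \<subseteq> {0<..}" and T: "finite T" "T \<subseteq> {0<..}" "X \<inter> T = {}"
    and card: "card X = Suc (card T)" and r: "r \<in> \<int> \<Longrightarrow> real (card X) \<le> \<bar>r\<bar>"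
    and S: "finite S" "S \<subseteq> {0<..}"
    and zero: "\<And>x. x \<in> X \<Longrightarrow> (\<Sum>y\<in>S. c y * loewner_kernel r x y) = 0"
    and sgn: "\<And>y. y \<in> S \<Longrightarrow> 0 \<le> c y * (\<Prod>\<tau>\<in>T. y - \<tau>)"
  shows "\<forall>y\<in>S - T. c y = 0"
proof
  fix y assume y: "y \<in> S - T"
  obtain d where d: "\<exists>x\<in>X. d x \<noteq> 0" "\<forall>\<tau>\<in>T. (\<Sum>x\<in>X. loewner_kernel r \<tau> x * d x) = 0"
    using homogeneous_system_nontrivial_solution[OF T(1) X(1), of "loewner_kernel r"] card by auto
  define g where "g t = (\<Sum>x\<in>X. d x * loewner_kernel r t x)" for t
  have gT: "g \<tau> = 0" if "\<tau> \<in> T" for \<tau> using d(2) that by (simp add: g_def mult.commute)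
  have g_nz: "g t \<noteq> 0" if "0 < t" "t \<notin> T" for t
  proof
    assume "g t = 0"
    with gT have "\<forall>x\<in>X. d x = 0"
      using X T r card that 
      by (intro loewner_combination_zero[of X r "insert t T" d "{}"]) (auto simp: g_def)
    with d(1) show False by auto
  qed
  have "\<exists>D. (g has_real_derivative D) (at \<tau>) \<and> D \<noteq> 0" if \<tau>: "\<tau> \<in> T" for \<tau>
  proof -
    have "\<forall>x\<in>X. \<exists>D. ((\<lambda>t. loewner_kernel r t x) has_real_derivative D) (at \<tau>)"
      using T \<tau> by (intro ballI differentiable_loewner_kernel) auto
    then obtain E where "\<forall>x\<in>X. ((\<lambda>t. loewner_kernel r t x) has_real_derivative E x) (at \<tau>)"
      by metis
    then have D: "(g has_real_derivative (\<Sum>x\<in>X. d x * E x)) (at \<tau>)"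
      unfolding g_def[abs_def] by (intro DERIV_sum DERIV_cmult) auto
    moreover have "(\<Sum>x\<in>X. d x * E x) \<noteq> 0"
    proof
      assume "(\<Sum>x\<in>X. d x * E x) = 0"
      with D gT \<tau> have "\<forall>x\<in>X. d x = 0"
        using X T r card
        by (intro loewner_combination_zero[of X r T d "{\<tau>}"]) (auto simp: g_def[abs_def])
      with d(1) show False by auto
    qed
    ultimately show ?thesis by blast
  qed
  then obtain g' where g': "\<And>\<tau>. \<tau> \<in> T \<Longrightarrow> (g has_real_derivative g' \<tau>) (at \<tau>) \<and> g' \<tau> \<noteq> 0" by metis
  define w where "w t = (\<Prod>\<tau>\<in>T. t - \<tau>)" for t
  \<comment> \<open>The quotient of \<open>g\<close> by \<open>\<Prod>\<tau>\<in>T. t - \<tau>\<close>, continued to \<open>T\<close>: it is continuous without zeros, so it has constant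
    sign on the positive axis.\<close>
  define u where "u t = (if t \<in> T then g' t / (\<Prod>\<tau>\<in>T - {t}. t - \<tau>) else g t / w t)" for t
  have w0: "w t = 0 \<longleftrightarrow> t \<in> T" for t using T by (auto simp: w_def)
  have guw: "g t = w t * u t" for t using gT w0[of t] by (auto simp: u_def)
  have u_nz: "u t \<noteq> 0" if "0 < t" for t
    using that g' g_nz w0[of t] T by (auto simp: u_def)
  have u_cont: "isCont u t" if t: "0 < t" for t
  proof (cases "t \<in> T")
    case True
    define v where "v s = (\<Prod>\<tau>\<in>T - {t}. s - \<tau>)" for s
    have v: "v t \<noteq> 0" using T by (auto simp: v_def)
    have wv: "w s = (s - t) * v s" for s unfolding w_def v_def using T True by (simp add: prod.remove)
    have "((\<lambda>s. (g s - g t) / (s - t)) \<longlongrightarrow> g' t) (at t)"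
      using g'[OF True] by (simp add: has_field_derivative_iff)
    moreover have "(v \<longlongrightarrow> v t) (at t)" unfolding v_def by (intro tendsto_intros)
    ultimately have "((\<lambda>s. (g s - g t) / (s - t) / v s) \<longlongrightarrow> g' t / v t) (at t)"
      using v by (rule tendsto_divide)
    moreover have "\<forall>\<^sub>F s in at t. (g s - g t) / (s - t) / v s = u s"
    proof -
      have "finite (T - {t})" using T by auto
      then have "open (- (T - {t}))" by (intro open_Compl finite_imp_closed)
      then have "\<forall>\<^sub>F s in at t. s \<notin> T - {t} \<and> s \<noteq> t"
        by (auto simp: eventually_at_filter eventually_nhds)
      then show ?thesis by eventually_elim (use gT True in \<open>auto simp: u_def wv\<close>)
    qed
    ultimately have "(u \<longlongrightarrow> g' t / v t) (at t)" by (rule Lim_transform_eventually)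
    then show ?thesis using True by (simp add: isCont_def u_def v_def)
  next
    case False
    have "isCont (\<lambda>s. g s / w s) t"
      unfolding g_def w_def using t X False T
      by (intro continuous_intros isCont_loewner_kernel) auto
    moreover have "open (- T)" using T by (simp add: finite_imp_closed open_Compl)
    then have "\<forall>\<^sub>F s in nhds t. g s / w s = u s"
      using False by (auto simp: eventually_nhds u_def)
    ultimately show ?thesis using isCont_cong by fast
  qed
  have u_sgn: "0 < u s * u t" if "0 < s" "0 < t" for s t
  proof -
    have "0 < u s * u t" if "0 < s" "s \<le> t" for s t
      using that u_cont u_nz
      by (intro nonvanishing_continuous_same_sign continuous_at_imp_continuous_on) auto
    then show ?thesis using that by (metis linear mult.commute)
  qed
  have "(\<Sum>y\<in>S. c y * g y) = (\<Sum>x\<in>X. d x * (\<Sum>y\<in>S. c y * loewner_kernel r x y))"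
    unfolding g_def sum_distrib_left by (subst sum.swap) (simp add: loewner_kernel_commute mult_ac)
  also have "\<dots> = 0" using zero by simp
  finally have sum0: "(\<Sum>y\<in>S. u 1 * (c y * g y)) = 0" by (simp add: sum_distrib_left[symmetric])
  have nonneg: "0 \<le> u 1 * (c t * g t)" if "t \<in> S" for t
  proof -
    have "0 \<le> c t * w t" using sgn[OF that] by (simp add: w_def)
    moreover have "0 < u 1 * u t" using u_sgn[of 1 t] S that by auto
    ultimately have "0 \<le> (c t * w t) * (u 1 * u t)"
      by (rule mult_nonneg_nonneg[OF _ less_imp_le])
    then show ?thesis unfolding guw by (simp add: mult_ac)
  qed
  have "\<forall>t\<in>S. u 1 * (c t * g t) = 0"
    using sum_nonneg_eq_0_iff[OF S(1), of "\<lambda>t. u 1 * (c t * g t)"] nonneg sum0 by blast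
  then have "u 1 * (c y * g y) = 0" using y by blast
  then show "c y = 0" using u_nz[of 1] g_nz[of y] y S by auto
qed

text \<open>
  The input for the variation argument, by induction on the largest point: whenever \<open>c\<close> switches sign
  between two points, so does \<open>f\<close>, and the gap between them contains a zero of \<open>f\<close> (collected in \<open>X\<close>) as
  well as room for a switching point different from it (collected in \<open>T\<close>). All of these points lie above
  some point with \<open>c y \<noteq> 0\<close>; so if \<open>c\<close> vanishes at the smallest point, then that point is a further zero of \<open>f\<close>.
\<close>
lemma sign_alternation_zeros:
  fixes c f :: "real \<Rightarrow> real"
  assumes "finite S" "S \<subseteq> {0<..}" and cont: "\<forall>t>0. isCont f t"
    and "\<forall>y\<in>S. f y = \<mu> * c y" and "\<mu> \<noteq> 0" "\<exists>y\<in>S. c y \<noteq> 0"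
  shows "\<exists>T X \<sigma> l. finite T \<and> finite X \<and> card X = card T \<and> X \<inter> T = {} \<and>
     l \<in> S \<and> 0 < \<sigma> * c l \<and> (\<forall>y\<in>S. l < y \<longrightarrow> c y = 0) \<and>
     (\<forall>x\<in>T \<union> X. x < l \<and> (\<exists>y\<in>S. c y \<noteq> 0 \<and> y < x)) \<and> (\<forall>x\<in>X. f x = 0) \<and>
     (\<forall>y\<in>S. 0 \<le> \<sigma> * c y * (\<Prod>\<tau>\<in>T. y - \<tau>))"
  using assms(1,2,4,6)
proof (induction S rule: finite_linorder_max_induct)
  case empty
  then show ?case by simp
next
  case (insert b A)
  show ?case
  proof (cases "\<exists>y\<in>A. c y \<noteq> 0")
    case False
    then have "c b \<noteq> 0" using insert.prems by auto
    then show ?thesis using False insert.hyps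
      by (intro exI[of _ "{}"] exI[of _ "c b"] exI[of _ b]) (auto simp: zero_less_mult_iff)
  next
    case True
    have A: "A \<subseteq> {0<..}" "\<forall>y\<in>A. f y = \<mu> * c y" using insert.prems by auto
    obtain T X \<sigma> l where I: "finite T" "finite X" "card X = card T" "X \<inter> T = {}"
      "l \<in> A" "0 < \<sigma> * c l" "\<forall>y\<in>A. l < y \<longrightarrow> c y = 0"
      "\<forall>x\<in>T \<union> X. x < l \<and> (\<exists>y\<in>A. c y \<noteq> 0 \<and> y < x)" "\<forall>x\<in>X. f x = 0"
      "\<forall>y\<in>A. 0 \<le> \<sigma> * c y * (\<Prod>\<tau>\<in>T. y - \<tau>)"
      using insert.IH[OF A True] by (elim exE conjE) (rule that)
    have lb: "l < b" "0 < l" using I insert by auto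
    have pos: "0 < (\<Prod>\<tau>\<in>T. b - \<tau>)" using I(8) lb by (intro prod_pos ballI) (auto dest!: bspec)
    consider "c b = 0" | "0 < \<sigma> * c b" | "\<sigma> * c b < 0" using I(6) by (cases "c b = 0"; cases "0 < \<sigma> * c b") (auto simp: not_less order_le_less)
    then show ?thesis
    proof cases
      case 1
      then show ?thesis using I
        by (intro exI[of _ T] exI[of _ X] exI[of _ \<sigma>] exI[of _ l]) auto
    next
      case 2
      have "x < b \<and> (\<exists>y\<in>insert b A. c y \<noteq> 0 \<and> y < x)" if "x \<in> T \<union> X" for x
      proof -
        have "x < l" "\<exists>y\<in>A. c y \<noteq> 0 \<and> y < x" using I(8) that by blast+
        then show ?thesis using lb by auto
      qed
      then have 4: "\<forall>x\<in>T \<union> X. x < b \<and> (\<exists>y\<in>insert b A. c y \<noteq> 0 \<and> y < x)" by blast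
      have 5: "\<forall>y\<in>insert b A. b < y \<longrightarrow> c y = 0" using insert.hyps by force
      have 6: "\<forall>y\<in>insert b A. 0 \<le> \<sigma> * c y * (\<Prod>\<tau>\<in>T. y - \<tau>)"
        using I(10) less_imp_le[OF mult_pos_pos[OF 2 pos]] by blast
      show ?thesis
        by (rule exI[of _ T], rule exI[of _ X], rule exI[of _ \<sigma>], rule exI[of _ b], intro conjI)
          (fact 2 4 5 6 I | simp)+
    next
      case 3
      have opp: "c l * c b < 0"
      proof (rule ccontr)
        assume "\<not> ?thesis"
        then have "0 \<le> \<sigma>\<^sup>2 * (c l * c b)" by simp
        moreover have "(\<sigma> * c l) * (\<sigma> * c b) < 0" using I(6) 3 by (rule mult_pos_neg)
        ultimately show False by (simp add: power2_eq_square mult_ac)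
      qed
      have "\<exists>x. l < x \<and> x < b \<and> f x = 0"
      proof (rule ccontr)
        assume *: "\<not> ?thesis"
        have "f l * f b = \<mu>\<^sup>2 * (c l * c b)"
          using insert.prems(2) I(5) by (simp add: power2_eq_square)
        then have neg: "f l * f b < 0" using opp assms(5) by (simp add: mult_less_0_iff)
        then have "f x \<noteq> 0" if "x \<in> {l..b}" for x 
          using * that by (cases "x = l"; cases "x = b") auto
        then have "0 < f l * f b" using lb cont
          by (intro nonvanishing_continuous_same_sign continuous_at_imp_continuous_on) auto
        with neg show False by simp
      qed
      then obtain x where x: "l < x" "x < b" "f x = 0" by blast
      \<comment> \<open>Any point strictly between \<open>l\<close> and \<open>b\<close> other than \<open>x\<close> would do as switching point.\<close>
      define t where "t = (l + x) / 2"
      have t: "l < t" "t < x" using x by (auto simp: t_def)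
      have lt: "z < l" if "z \<in> T \<union> X" for z using I(8) that by blast
      have new: "t \<notin> T" "x \<notin> X" "t \<notin> X" "x \<notin> T" using lt[of t] lt[of x] t x by auto
      have low: "x' < b \<and> (\<exists>y\<in>insert b A. c y \<noteq> 0 \<and> y < x')" if "x' \<in> insert t T \<union> insert x X" for x'
      proof (cases "x' \<in> T \<union> X")
        case True
        then have "x' < l" "\<exists>y\<in>A. c y \<noteq> 0 \<and> y < x'" using I(8) by blast+
        then show ?thesis using lb by auto
      next
        case False
        then have "x' = t \<or> x' = x" using that by auto
        then show ?thesis using t x I(5,6) by (auto intro!: bexI[of _ l])
      qed
      have "0 \<le> - \<sigma> * c y * (\<Prod>\<tau>\<in>insert t T. y - \<tau>)" if y: "y \<in> insert b A" for y
      proof -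
        have eq: "- \<sigma> * c y * (\<Prod>\<tau>\<in>insert t T. y - \<tau>) = (t - y) * (\<sigma> * c y * (\<Prod>\<tau>\<in>T. y - \<tau>))"
          using new I by (simp add: algebra_simps)
        show ?thesis
        proof (cases "y = b")
          case True
          have "\<sigma> * c b * (\<Prod>\<tau>\<in>T. b - \<tau>) \<le> 0"
            using less_imp_le[OF mult_neg_pos[OF 3 pos]] .
          then show ?thesis unfolding True eq[unfolded True] using t x by (intro mult_nonpos_nonpos) auto
        next
          case False
          then have "y \<in> A" using y by auto
          then have "y \<le> l \<or> c y = 0" using I(7) by force
          then show ?thesis unfolding eq using I(10) \<open>y \<in> A\<close> t by auto
        qed
      qed
      then have 4: "\<forall>y\<in>insert b A. 0 \<le> - \<sigma> * c y * (\<Prod>\<tau>\<in>insert t T. y - \<tau>)" by blast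
      have 5: "\<forall>y\<in>insert b A. b < y \<longrightarrow> c y = 0" using insert.hyps by force
      have 6: "\<forall>x\<in>insert t T \<union> insert x X. x < b \<and> (\<exists>y\<in>insert b A. c y \<noteq> 0 \<and> y < x)"
        using low by blast
      have 7: "card (insert x X) = card (insert t T)" "insert x X \<inter> insert t T = {}"
        "0 < - \<sigma> * c b" "\<forall>z\<in>insert x X. f z = 0" "finite (insert t T)" "finite (insert x X)"
        using I(1-4,9) new 3 x t by auto
      show ?thesis
        by (rule exI[of _ "insert t T"], rule exI[of _ "insert x X"], rule exI[of _ "- \<sigma>"],
            rule exI[of _ b], intro conjI) (fact 4 5 6 7 | simp)+
    qed
  qed
qed

lemma loewner_kernel_of_nat:
  assumes "0 < x" "0 < y" "0 < m"
  shows "loewner_kernel (real m) x y = (\<Sum>j<m. x ^ j * y ^ (m - 1 - j))"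
proof -
  obtain n where m: "m = Suc n" using assms by (cases m) auto
  show ?thesis
  proof (cases "x = y")
    case True
    have "(\<Sum>j<m. x ^ j * x ^ (m - 1 - j)) = (\<Sum>j<m. x ^ n)"
      by (rule sum.cong) (auto simp: m power_add[symmetric])
    then show ?thesis using True assms by (simp add: loewner_kernel_def m powr_realpow)
  next
    case False
    then show ?thesis using assms diff_power_eq_sum[of x n y]
      by (simp add: loewner_kernel_def m powr_realpow del: power_Suc sum.lessThan_Suc of_nat_Suc)
  qed
qed

text \<open>
  Were the first component zero, then \<open>f\<close> would vanish at the first point in addition to its zeros forced
  by the sign changes of \<open>c\<close>, which contradicts variation diminishing. If \<open>r\<close> is a positive integer, then
  \<open>f\<close> is a nonzero polynomial of degree less than \<open>r\<close>, so that \<open>f\<close> has fewer than \<open>r\<close> zeros and the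
  arithmetic condition on \<open>r\<close> in the zero count is met.
\<close>
lemma eigenvector_first_component_nonzero:
  fixes c :: "real \<Rightarrow> real"
  assumes S: "finite S" "S \<subseteq> {0<..}" and "0 < r" "\<mu> \<noteq> 0"
    and eig: "\<And>x. x \<in> S \<Longrightarrow> (\<Sum>y\<in>S. c y * loewner_kernel r x y) = \<mu> * c x"
    and nz: "\<exists>y\<in>S. c y \<noteq> 0"
  shows "c (Min S) \<noteq> 0"
proof
  assume c0: "c (Min S) = 0"
  define f where "f t = (\<Sum>y\<in>S. c y * loewner_kernel r t y)" for t
  have cont: "\<forall>t>0. isCont f t"
    unfolding f_def using S by (intro allI impI continuous_intros isCont_loewner_kernel) auto
  have f_eig: "\<forall>y\<in>S. f y = \<mu> * c y" using eig f_def by simp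
  obtain T X \<sigma> l where I: "finite T" "finite X" "card X = card T" "X \<inter> T = {}"
      "l \<in> S" "0 < \<sigma> * c l" "\<forall>y\<in>S. l < y \<longrightarrow> c y = 0"
      "\<forall>x\<in>T \<union> X. x < l \<and> (\<exists>y\<in>S. c y \<noteq> 0 \<and> y < x)" "\<forall>x\<in>X. f x = 0"
      "\<forall>y\<in>S. 0 \<le> \<sigma> * c y * (\<Prod>\<tau>\<in>T. y - \<tau>)"
    using sign_alternation_zeros[OF S cont f_eig \<open>\<mu> \<noteq> 0\<close> nz] by (elim exE conjE) (rule that)
  have Min: "Min S \<in> S" "\<And>y. y \<in> S \<Longrightarrow> Min S \<le> y" using S nz by (auto intro: Min_in)
  have above: "Min S < x" if "x \<in> T \<union> X" for x 
  proof -
    have "\<exists>y\<in>S. c y \<noteq> 0 \<and> y < x" using I(8) that by blast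
    then show ?thesis using Min(2) by (meson le_less_trans)
  qed
  define X' where "X' = insert (Min S) X"
  have Min_pos: "0 < Min S" using S Min by auto
  have Min_notin: "Min S \<notin> T \<union> X" using above by force
  have X': "finite X'" "X' \<subseteq> {0<..}" "X' \<inter> T = {}" "card X' = Suc (card T)"
    using I(1-4) above Min_pos Min_notin by (auto simp: X'_def intro: less_trans)
  have fX': "f x = 0" if "x \<in> X'" for x
    using that I(9) f_eig Min(1) c0 by (auto simp: X'_def)
  have "real (card X') \<le> \<bar>r\<bar>" if "r \<in> \<int>"
  proof (rule ccontr)
    assume less: "\<not> ?thesis"
    obtain m where m: "r = real m" "0 < m"
      using \<open>r \<in> \<int>\<close> \<open>0 < r\<close> by (metis Ints_cases of_int_0_less_iff of_nat_0_less_iff of_int_of_nat_eq zero_less_imp_eq_int)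
    define a where "a j = (\<Sum>y\<in>S. c y * y ^ (m - 1 - j))" for j
    have f_sum: "f t = (\<Sum>j<m. a j * t powr real j)" if "0 < t" for t
    proof -
      have "f t = (\<Sum>y\<in>S. \<Sum>j<m. c y * (t ^ j * y ^ (m - 1 - j)))"
        unfolding f_def m(1) sum_distrib_left[symmetric] using S m that
        by (intro sum.cong refl) (auto simp: loewner_kernel_of_nat)
      also have "\<dots> = (\<Sum>j<m. a j * t ^ j)"
        by (subst sum.swap) (simp add: a_def sum_distrib_left sum_distrib_right mult_ac)
      finally show ?thesis using that by (simp add: powr_realpow)
    qed
    have "\<forall>j\<in>{..<m}. a j = 0"
    proof (rule generalized_polynomial_zeros[of "{..<m}" real X' "{}"])
      show "0 < z \<and> (\<Sum>j<m. a j * z powr real j) = 0" if "z \<in> X'" for z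
        using X'(2) fX'[OF that] that f_sum[of z] by auto
    qed (use X' less m in \<open>auto simp: inj_on_def\<close>)
    then have "f l = 0" using f_sum[of l] I(5) S by auto
    then show False using f_eig I(5) \<open>\<mu> \<noteq> 0\<close> I(6) by auto
  qed
  moreover have "(\<Sum>y\<in>S. \<sigma> * c y * loewner_kernel r x y) = 0" if "x \<in> X'" for x
    using fX'[OF that] by (simp add: f_def mult.assoc sum_distrib_left[symmetric])
  ultimately have "\<forall>y\<in>S - T. \<sigma> * c y = 0"
    using X' I(1,10) S above Min_pos
    by (intro variation_diminishing[of X' T r]) (auto intro: less_trans)
  moreover have "l \<notin> T" using I(8) by force
  ultimately show False using I(5,6) by auto
qed

section \<open>Spectral decomposition of real symmetric matrices\<close>

lemma scalar_prod_self_nonneg_zero: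
  fixes v :: "real vec" assumes "v \<in> carrier_vec n"
  shows "0 \<le> v \<bullet> v" "v \<bullet> v = 0 \<longleftrightarrow> v = 0\<^sub>v n"
proof -
  have *: "v \<bullet> v = (\<Sum>i<n. (v $ i)\<^sup>2)"
    using assms by (auto simp: scalar_prod_def power2_eq_square atLeast0LessThan)
  show "0 \<le> v \<bullet> v" unfolding * by (intro sum_nonneg) auto
  show "v \<bullet> v = 0 \<longleftrightarrow> v = 0\<^sub>v n"
    unfolding * using assms by (subst sum_nonneg_eq_0_iff) (auto intro!: eq_vecI)
qed

text \<open>
  Over the complex numbers there is an eigenvalue \<open>z\<close> with eigenvector \<open>w\<close>; the Hermitian form
  \<open>s\<close> of \<open>w\<close> equals \<open>z\<close> times the squared norm of \<open>w\<close> and is real by symmetry.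
\<close>
lemma symmetric_mat_has_eigenvalue:
  fixes A :: "real mat"
  assumes A: "A \<in> carrier_mat n n" and sym: "A\<^sup>T = A" and n: "0 < n"
  shows "\<exists>l. eigenvalue A l"
proof -
  let ?B = "map_mat complex_of_real A"
  have B: "?B \<in> carrier_mat n n" using A by simp
  obtain as where as: "char_poly ?B = (\<Prod>a\<leftarrow>as. [:- a, 1:])" "length as = n"
    using char_poly_factorized[OF B] by blast
  then obtain z where z: "z \<in> set as" using n by (cases as) auto
  have "poly (char_poly ?B) z = 0" using z unfolding as(1) poly_prod_list
    by (auto simp: prod_list_zero_iff)
  then have "eigenvalue ?B z" using eigenvalue_root_char_poly[OF B] by simp
  then obtain w where w: "w \<in> carrier_vec n" "w \<noteq> 0\<^sub>v n" "?B *\<^sub>v w = z \<cdot>\<^sub>v w"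
    using A unfolding eigenvalue_def eigenvector_def by auto
  have entry: "(\<Sum>j<n. of_real (A $$ (i,j)) * w $ j) = z * w $ i" if "i < n" for i
    using arg_cong[OF w(3), of "\<lambda>v. v $ i"] that A w(1)
    by (simp add: scalar_prod_def atLeast0LessThan)
  have symE: "A $$ (i,j) = A $$ (j,i)" if "i < n" "j < n" for i j
    using arg_cong[OF sym, of "\<lambda>M. M $$ (i,j)"] that A by simp
  define N where "N = (\<Sum>i<n. (cmod (w $ i))\<^sup>2)"
  obtain i where "i < n" "w $ i \<noteq> 0" using w by (metis carrier_vecD eq_vecI index_zero_vec)
  then have N: "0 < N" unfolding N_def by (intro sum_pos2[of _ i]) auto
  define s where "s = (\<Sum>i<n. \<Sum>j<n. cnj (w $ i) * (of_real (A $$ (i,j)) * w $ j))"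
  have "s = (\<Sum>i<n. cnj (w $ i) * (z * w $ i))"
    unfolding s_def sum_distrib_left[symmetric] using entry by simp
  also have "\<dots> = z * of_real N"
    unfolding N_def of_real_sum complex_norm_square sum_distrib_left by (simp add: mult_ac)
  finally have sz: "s = z * of_real N" .
  have "cnj s = (\<Sum>i<n. \<Sum>j<n. w $ i * (of_real (A $$ (i,j)) * cnj (w $ j)))"
    by (simp add: s_def)
  also have "\<dots> = s" unfolding s_def
    by (subst sum.swap) (auto intro!: sum.cong simp: symE mult_ac)
  finally have "cnj z = z" using N sz by auto
  then have "z = of_real (Re z)" by (simp add: complex_eq_iff)
  moreover have "poly (char_poly ?B) (of_real (Re z)) = of_real (poly (char_poly A) (Re z))"
    using A by (simp add: of_real_hom.char_poly_hom)
  ultimately have "poly (char_poly A) (Re z) = 0"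
    using \<open>poly (char_poly ?B) z = 0\<close> by (metis of_real_eq_0_iff)
  then show ?thesis using eigenvalue_root_char_poly[OF A] by blast
qed

text \<open>
  The reflection in the hyperplane orthogonal to \<open>v\<close> minus the last unit vector exchanges these two unit
  vectors. If they coincide, then \<open>s\<close> is a division by zero, hence \<open>s = 0\<close> and \<open>H\<close> is the identity,
  as desired.
\<close>
lemma householder_reflection:
  fixes v :: "real vec"
  assumes v: "v \<in> carrier_vec (Suc n)" "v \<bullet> v = 1"
  shows "\<exists>H. H \<in> carrier_mat (Suc n) (Suc n) \<and> H\<^sup>T = H \<and> H * H = 1\<^sub>m (Suc n) \<and> H *\<^sub>v unit_vec (Suc n) n = v"
proof -
  define w where "w = v - unit_vec (Suc n) n"
  have w: "w \<in> carrier_vec (Suc n)" using v by (simp add: w_def)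
  define s where "s = 2 / (w \<bullet> w)"
  define H where "H = mat (Suc n) (Suc n) (\<lambda>(i,j). (if i = j then 1 else 0) - s * (w $ i * w $ j))"
  have H: "H \<in> carrier_mat (Suc n) (Suc n)" by (simp add: H_def)
  have ww: "w \<bullet> w = (\<Sum>i<Suc n. w $ i * w $ i)"
    using w by (simp add: scalar_prod_def atLeast0LessThan)
  have vv: "(\<Sum>i<Suc n. v $ i * v $ i) = 1"
    using v by (simp add: scalar_prod_def atLeast0LessThan)
  have w_i: "w $ i = v $ i - (if i = n then 1 else 0)" if "i < Suc n" for i
    using that v by (simp add: w_def)
  have "(\<Sum>i<n. w $ i * w $ i) = (\<Sum>i<n. v $ i * v $ i)"
    by (rule sum.cong) (auto simp: w_i)
  then have ww2: "w \<bullet> w = 2 - 2 * v $ n" unfolding ww using vv by (simp add: w_i algebra_simps)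
  \<comment> \<open>Valid also for \<open>w \<bullet> w = 0\<close>, because then \<open>s = 0\<close>.\<close>
  have sw: "s * (s * (w \<bullet> w)) = 2 * s" by (simp add: s_def)
  have "H\<^sup>T = H" by (rule eq_matI) (auto simp: H_def mult_ac)
  moreover have "H * H = 1\<^sub>m (Suc n)"
  proof (rule eq_matI)
    fix i j assume "i < dim_row (1\<^sub>m (Suc n) :: real mat)" "j < dim_col (1\<^sub>m (Suc n) :: real mat)"
    then have ij: "i < Suc n" "j < Suc n" by auto
    let ?\<delta> = "\<lambda>i j. if i = j then 1 else 0 :: real"
    have "(H * H) $$ (i,j) = (\<Sum>k<Suc n. (?\<delta> i k - s * (w $ i * w $ k)) * (?\<delta> k j - s * (w $ k * w $ j)))"
      using ij by (simp add: H_def scalar_prod_def atLeast0LessThan del: sum.lessThan_Suc)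
    also have "\<dots> = (\<Sum>k<Suc n. ?\<delta> i k * ?\<delta> k j) - (\<Sum>k<Suc n. ?\<delta> i k * (s * (w $ k * w $ j)))
        - (\<Sum>k<Suc n. ?\<delta> k j * (s * (w $ i * w $ k))) + w $ i * w $ j * (s * (s * (\<Sum>k<Suc n. w $ k * w $ k)))"
      unfolding sum_distrib_left sum_subtractf[symmetric] sum.distrib[symmetric]
      by (rule sum.cong) (simp_all add: algebra_simps)
    also have "\<dots> = ?\<delta> i j - s * (w $ i * w $ j) - s * (w $ i * w $ j) + w $ i * w $ j * (2 * s)"
      unfolding ww[symmetric] sw
      using ij by (simp add: if_distrib[of "\<lambda>x. x * _"] if_distrib[of "\<lambda>x. _ * x"] del: sum.lessThan_Suc cong: if_cong)
    finally show "(H * H) $$ (i,j) = 1\<^sub>m (Suc n) $$ (i,j)" using ij by simp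
  qed (auto simp: H_def)
  moreover have "H *\<^sub>v unit_vec (Suc n) n = v"
  proof (rule eq_vecI)
    fix i assume "i < dim_vec v"
    then have i: "i < Suc n" using v by simp
    have "(H *\<^sub>v unit_vec (Suc n) n) $ i = H $$ (i, n)"
      using i H by simp
    also have "\<dots> = (if i = n then 1 else 0) - s * w $ n * w $ i" using i by (simp add: H_def)
    also have "\<dots> = v $ i"
    proof (cases "v $ n = 1")
      case True
      then have "w \<bullet> w = 0" using ww2 by simp
      then have "w = 0\<^sub>v (Suc n)" using scalar_prod_self_nonneg_zero(2)[OF w] by simp
      then show ?thesis using w_i[OF i] i by simp
    next
      case False
      then have "s * w $ n = - 1" unfolding s_def ww2 w_i[of n, simplified] by (simp add: field_simps)
      then show ?thesis using w_i[OF i] by simp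
    qed
    finally show "(H *\<^sub>v unit_vec (Suc n) n) $ i = v $ i" .
  qed (use v H in auto)
  ultimately show ?thesis using H by blast
qed

text \<open>
  Conjugation with a Householder reflection moves a unit eigenvector to the last unit vector; symmetry
  then splits off the last row and column, and the induction hypothesis applies to the remaining block.
\<close>
lemma symmetric_mat_diagonalization:
  fixes A :: "real mat"
  assumes "A \<in> carrier_mat n n" "A\<^sup>T = A"
  shows "\<exists>U d. U \<in> carrier_mat n n \<and> U * U\<^sup>T = 1\<^sub>m n \<and> U\<^sup>T * U = 1\<^sub>m n \<and> A = U * mat_diag n d * U\<^sup>T"
  using assms
proof (induction n arbitrary: A)
  case 0
  then show ?case by (intro exI[of _ A] exI[of _ "\<lambda>_. 0"]) (auto intro!: eq_matI)
next
  case (Suc n)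
  note A = Suc.prems(1)
  obtain l w where w: "w \<in> carrier_vec (Suc n)" "w \<noteq> 0\<^sub>v (Suc n)" "A *\<^sub>v w = l \<cdot>\<^sub>v w"
    using symmetric_mat_has_eigenvalue[OF Suc.prems] A unfolding eigenvalue_def eigenvector_def by auto
  have ww: "0 < w \<bullet> w" using scalar_prod_self_nonneg_zero[OF w(1)] w(2) by linarith
  define v where "v = (1 / sqrt (w \<bullet> w)) \<cdot>\<^sub>v w"
  have v: "v \<in> carrier_vec (Suc n)" "v \<bullet> v = 1" "A *\<^sub>v v = l \<cdot>\<^sub>v v"
  proof -
    show "v \<in> carrier_vec (Suc n)" using w by (simp add: v_def)
    have "v \<bullet> v = w \<bullet> w / (sqrt (w \<bullet> w))\<^sup>2"
      using w by (simp add: v_def power2_eq_square)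
    then show "v \<bullet> v = 1" using ww by simp
    show "A *\<^sub>v v = l \<cdot>\<^sub>v v"
      using w A by (simp add: v_def mult_mat_vec smult_smult_assoc mult.commute)
  qed
  obtain H where H: "H \<in> carrier_mat (Suc n) (Suc n)" "H\<^sup>T = H" "H * H = 1\<^sub>m (Suc n)"
    "H *\<^sub>v unit_vec (Suc n) n = v"
    using householder_reflection[OF v(1,2)] by blast
  define B where "B = H * A * H"
  have B: "B \<in> carrier_mat (Suc n) (Suc n)" using H A by (simp add: B_def)
  have BT: "B\<^sup>T = B"
  proof -
    have "B\<^sup>T = H\<^sup>T * (A\<^sup>T * H\<^sup>T)" unfolding B_def using H A
      by (subst transpose_mult[of _ "Suc n" "Suc n" _ "Suc n"], simp_all)
         (subst transpose_mult[of _ "Suc n" "Suc n" _ "Suc n"], simp_all)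
    then show ?thesis unfolding H Suc.prems B_def using H(1) A by (simp add: assoc_mult_mat[of _ "Suc n" "Suc n" _ "Suc n" _ "Suc n"])
  qed
  let ?e = "unit_vec (Suc n) n :: real vec"
  have "B *\<^sub>v ?e = (H * A) *\<^sub>v (H *\<^sub>v ?e)"
    unfolding B_def using H(1) A by (intro assoc_mult_mat_vec[of _ "Suc n" "Suc n" _ "Suc n"]) auto
  also have "\<dots> = H *\<^sub>v (A *\<^sub>v (H *\<^sub>v ?e))"
    using H(1) A by (intro assoc_mult_mat_vec[of _ "Suc n" "Suc n" _ "Suc n"]) auto
  also have "\<dots> = l \<cdot>\<^sub>v (H *\<^sub>v (H *\<^sub>v ?e))" unfolding H v using H v by (simp add: mult_mat_vec)
  also have "H *\<^sub>v (H *\<^sub>v ?e) = (H * H) *\<^sub>v ?e" using H(1) by (simp add: assoc_mult_mat_vec[of _ "Suc n" "Suc n"])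
  finally have Be: "B *\<^sub>v ?e = l \<cdot>\<^sub>v ?e" unfolding H by simp
  have Bn: "B $$ (i, n) = (if i = n then l else 0)" if "i < Suc n" for i
    using arg_cong[OF Be, of "\<lambda>v. v $ i"] that B by simp
  have Bn': "B $$ (n, i) = (if i = n then l else 0)" if "i < Suc n" for i
    using arg_cong[OF BT, of "\<lambda>M. M $$ (n, i)"] Bn[OF that] that B by simp
  define C where "C = mat n n (\<lambda>ij. B $$ ij)"
  have C: "C \<in> carrier_mat n n" "C\<^sup>T = C"
  proof -
    have "B $$ (j, i) = B $$ (i, j)" if "i < n" "j < n" for i j
      using arg_cong[OF BT, of "\<lambda>M. M $$ (i, j)"] that B by simp
    then show "C\<^sup>T = C" by (intro eq_matI) (auto simp: C_def)
  qed (simp add: C_def)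
  define L where "L = mat 1 1 (\<lambda>_. l)"
  have BC: "B = four_block_mat C (0\<^sub>m n 1) (0\<^sub>m 1 n) L"
    using B Bn Bn' by (intro eq_matI) (auto simp: C_def L_def less_Suc_eq)
  obtain U d where U: "U \<in> carrier_mat n n" "U * U\<^sup>T = 1\<^sub>m n" "U\<^sup>T * U = 1\<^sub>m n"
    "C = U * mat_diag n d * U\<^sup>T" using Suc.IH[OF C] by blast
  define V where "V = four_block_mat U (0\<^sub>m n 1) (0\<^sub>m 1 n) (1\<^sub>m 1)"
  define D where "D = mat_diag (Suc n) (d(n := l))"
  have D: "D = four_block_mat (mat_diag n d) (0\<^sub>m n 1) (0\<^sub>m 1 n) L"
    by (rule eq_matI) (auto simp: D_def mat_diag_def L_def)
  have VT: "V\<^sup>T = four_block_mat U\<^sup>T (0\<^sub>m n 1) (0\<^sub>m 1 n) (1\<^sub>m 1)"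
    unfolding V_def using U by (subst transpose_four_block_mat[of _ n n _ 1 _ 1]) auto
  have "V \<in> carrier_mat (n + 1) (n + 1)" unfolding V_def
    by (rule four_block_carrier_mat[OF U(1)]) simp
  then have V: "V \<in> carrier_mat (Suc n) (Suc n)" by simp
  have L: "L \<in> carrier_mat 1 1" by (simp add: L_def)
  have mult: "four_block_mat P (0\<^sub>m n 1) (0\<^sub>m 1 n) R * four_block_mat P' (0\<^sub>m n 1) (0\<^sub>m 1 n) R'
      = four_block_mat (P * P') (0\<^sub>m n 1) (0\<^sub>m 1 n) (R * R')"
    if "P \<in> carrier_mat n n" "R \<in> carrier_mat 1 1" "P' \<in> carrier_mat n n" "R' \<in> carrier_mat 1 1" for P R P' R' :: "real mat"
    using that by (subst mult_four_block_mat[of _ n n _ 1 _ 1 _ _ n _ 1]) auto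
  have one: "four_block_mat (1\<^sub>m n) (0\<^sub>m n 1) (0\<^sub>m 1 n) (1\<^sub>m 1) = (1\<^sub>m (Suc n) :: real mat)" by simp
  have VVT: "V * V\<^sup>T = 1\<^sub>m (Suc n)" "V\<^sup>T * V = 1\<^sub>m (Suc n)"
    unfolding VT unfolding V_def using U by (subst mult; simp)+
  have BV: "B = V * D * V\<^sup>T"
    unfolding VT D unfolding V_def BC using U L by (simp add: mult[unfolded One_nat_def])
  define W where "W = H * V"
  have W: "W \<in> carrier_mat (Suc n) (Suc n)" using H V by (simp add: W_def)
  have Dc: "D \<in> carrier_mat (Suc n) (Suc n)" by (simp add: D_def)
  note assoc = assoc_mult_mat[of _ "Suc n" "Suc n" _ "Suc n" _ "Suc n"]
  have WT: "W\<^sup>T = V\<^sup>T * H"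
    unfolding W_def using H V by (subst transpose_mult[of _ "Suc n" "Suc n" _ "Suc n"]) auto
  have "W * W\<^sup>T = H * (V * V\<^sup>T) * H" unfolding WT unfolding W_def using H(1) V by (simp add: assoc)
  then have 1: "W * W\<^sup>T = 1\<^sub>m (Suc n)" using H VVT by simp
  have 2: "W\<^sup>T * W = 1\<^sub>m (Suc n)" using mat_mult_left_right_inverse[OF W _ 1] W by simp
  have "A = (H * H) * A * (H * H)" unfolding H using A by simp
  also have "\<dots> = H * B * H" unfolding B_def using H(1) A by (simp add: assoc)
  also have "\<dots> = W * D * W\<^sup>T" unfolding BV WT unfolding W_def using H(1) V Dc by (simp add: assoc)
  finally show ?case using W 1 2 D_def by blast
qed

text \<open>
  A spectral decomposition in terms of entries: \<open>u k\<close> is a unit eigenvector for \<open>d k\<close>. Entry functions,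
  unlike matrices, restrict to leading principal submatrices by lowering \<open>n\<close> alone.
\<close>
definition eigensystem :: "nat \<Rightarrow> (nat \<Rightarrow> nat \<Rightarrow> real) \<Rightarrow> (nat \<Rightarrow> real) \<Rightarrow> (nat \<Rightarrow> nat \<Rightarrow> real) \<Rightarrow> bool" where
  "eigensystem n a d u \<longleftrightarrow>
    (\<forall>i<n. \<forall>j<n. a i j = (\<Sum>k<n. d k * u k i * u k j)) \<and>
    (\<forall>k<n. \<forall>l<n. (\<Sum>i<n. u k i * u l i) = (if k = l then 1 else 0))"

lemma symmetric_eigensystem:
  fixes a :: "nat \<Rightarrow> nat \<Rightarrow> real"
  assumes "\<And>i j. i < n \<Longrightarrow> j < n \<Longrightarrow> a i j = a j i"
  shows "\<exists>d u. eigensystem n a d u"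
proof -
  define A where "A = mat n n (\<lambda>(i,j). a i j)"
  have A: "A \<in> carrier_mat n n" "A\<^sup>T = A"
    using assms by (auto simp: A_def intro!: eq_matI)
  obtain U d where U: "U \<in> carrier_mat n n" "U\<^sup>T * U = 1\<^sub>m n" "A = U * mat_diag n d * U\<^sup>T"
    using symmetric_mat_diagonalization[OF A] by blast
  have "(\<Sum>i<n. U $$ (i,k) * U $$ (i,l)) = (if k = l then 1 else 0)" if "k < n" "l < n" for k l
    using arg_cong[OF U(2), of "\<lambda>M. M $$ (k,l)"] that U(1)
    by (simp add: scalar_prod_def atLeast0LessThan)
  moreover have "a i j = (\<Sum>k<n. d k * U $$ (i,k) * U $$ (j,k))" if "i < n" "j < n" for i j
  proof -
    have "a i j = (U * mat_diag n d * U\<^sup>T) $$ (i,j)" using that by (simp add: A_def flip: U(3))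
    also have "\<dots> = (\<Sum>k<n. d k * U $$ (i,k) * U $$ (j,k))"
      using that U(1) by (simp add: mat_diag_mult_right[of _ n n] scalar_prod_def atLeast0LessThan mult_ac)
    finally show ?thesis .
  qed
  ultimately show ?thesis unfolding eigensystem_def
    by (intro exI[of _ d] exI[of _ "\<lambda>k i. U $$ (i,k)"]) auto
qed

lemma eigensystem_char_poly:
  assumes "eigensystem n a d u"
  shows "char_poly (mat n n (\<lambda>(i,j). a i j)) = (\<Prod>k<n. [:- d k, 1:])"
proof -
  let ?A = "mat n n (\<lambda>(i,j). a i j)"
  define U where "U = mat n n (\<lambda>(i,k). u k i)"
  have U: "U \<in> carrier_mat n n" by (simp add: U_def)
  have 1: "U\<^sup>T * U = 1\<^sub>m n"
    using assms by (intro eq_matI) (auto simp: U_def scalar_prod_def eigensystem_def atLeast0LessThan)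
  have 2: "U * U\<^sup>T = 1\<^sub>m n" using mat_mult_left_right_inverse[OF _ U 1] U by simp
  have "?A = U * mat_diag n d * U\<^sup>T"
    using assms by (intro eq_matI)
      (auto simp: U_def mat_diag_mult_right[of _ n n] scalar_prod_def eigensystem_def atLeast0LessThan mult_ac)
  then have "similar_mat ?A (mat_diag n d)"
    using U 1 2 by (intro similar_matI[of _ _ U "U\<^sup>T" n]) auto
  then have "char_poly ?A = char_poly (mat_diag n d)" by (rule char_poly_similar)
  also have "\<dots> = (\<Prod>a\<leftarrow>diag_mat (mat_diag n d). [:- a, 1:])"
    by (rule char_poly_upper_triangular[of _ n]) (auto simp: mat_diag_def)
  also have "diag_mat (mat_diag n d) = map d [0..<n]"
    by (auto simp: diag_mat_def mat_diag_def)
  also have "(\<Prod>a\<leftarrow>map d [0..<n]. [:- a, 1:]) = (\<Prod>k<n. [:- d k, 1:])"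
    by (simp add: prod.list_conv_set_nth atLeast0LessThan)
  finally show ?thesis .
qed

lemma eigensystem_det:
  assumes "eigensystem n a d u"
  shows "det (mat n n (\<lambda>(i,j). a i j)) = (\<Prod>k<n. d k)"
proof -
  let ?A = "mat n n (\<lambda>(i,j). a i j)"
  have "poly (char_poly ?A) 0 = det (- (char_matrix ?A 0))" by (rule char_poly_matrix[of _ n]) simp
  also have "- (char_matrix ?A 0) = - 1 \<cdot>\<^sub>m ?A" by (auto simp: char_matrix_def intro!: eq_matI)
  also have "det \<dots> = (- 1) ^ n * det ?A" by simp
  finally have "(- 1) ^ n * det ?A = (\<Prod>k<n. - d k)" 
    unfolding eigensystem_char_poly[OF assms] by (simp add: poly_prod)
  also have "\<dots> = (- 1) ^ n * (\<Prod>k<n. d k)" by (simp add: prod_uminus)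
  finally show ?thesis by simp
qed

lemma eigensystem_eig_mult:
  assumes "eigensystem n a d u"
  shows "eig_mult (mat n n (\<lambda>(i,j). a i j)) x = card {k. k < n \<and> d k = x}"
proof -
  have "Polynomial.order x (\<Prod>k\<in>K. [:- d k, 1:]) = card {k\<in>K. d k = x}" if "finite K" for K
    using that
  proof (induction K rule: finite_induct)
    case (insert k K)
    have eq: "(\<Prod>k\<in>insert k K. [:- d k, 1:]) = [:- d k, 1:] * (\<Prod>k\<in>K. [:- d k, 1:])"
      using insert.hyps by (rule prod.insert)
    have "(\<Prod>k\<in>K. [:- d k, 1:]) \<noteq> 0" using insert.hyps by auto
    then have nz: "[:- d k, 1:] * (\<Prod>k\<in>K. [:- d k, 1:]) \<noteq> 0" by (intro no_zero_divisors) simp_all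
    have "Polynomial.order x [:- d k, 1:] = (if d k = x then 1 else 0)"
      using order_power_n_n[of x 1] by (auto intro: order_0I)
    moreover have "{j \<in> insert k K. d j = x} = (if d k = x then insert k {j\<in>K. d j = x} else {j\<in>K. d j = x})"
      by auto
    ultimately show ?case unfolding eq order_mult[OF nz] using insert.hyps insert.IH by simp
  qed simp
  from this[of "{..<n}"] show ?thesis
    unfolding eig_mult_def eigensystem_char_poly[OF assms] by simp
qed

lemma eigensystem_eigenvalue:
  assumes "eigensystem n a d u"
  shows "eigenvalue (mat n n (\<lambda>(i,j). a i j)) x \<longleftrightarrow> (\<exists>k<n. d k = x)"
  by (subst eigenvalue_root_char_poly[of _ n])
    (auto simp: eigensystem_char_poly[OF assms] poly_prod prod_zero_iff)

lemma eigensystem_inertia: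
  assumes "eigensystem n a d u"
  shows "inertia (mat n n (\<lambda>(i,j). a i j)) =
    (card {k. k < n \<and> 0 < d k}, card {k. k < n \<and> d k = 0}, card {k. k < n \<and> d k < 0})"
proof -
  have "(\<Sum>x\<in>{x. P x \<and> (\<exists>k<n. d k = x)}. card {k. k < n \<and> d k = x}) = card {k. k < n \<and> P (d k)}" for P
  proof -
    let ?X = "{x. P x \<and> (\<exists>k<n. d k = x)}"
    have "finite ?X" by (rule finite_subset[of _ "d ` {..<n}"]) auto
    then have "card (\<Union>x\<in>?X. {k. k < n \<and> d k = x}) = (\<Sum>x\<in>?X. card {k. k < n \<and> d k = x})"
      by (rule card_UN_disjoint) auto
    moreover have "(\<Union>x\<in>?X. {k. k < n \<and> d k = x}) = {k. k < n \<and> P (d k)}" by auto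
    ultimately show ?thesis by simp
  qed
  then show ?thesis unfolding inertia_def
    by (simp add: eigensystem_eigenvalue[OF assms] eigensystem_eig_mult[OF assms])
qed

section \<open>Comparison of inertias\<close>

definition quadratic_form :: "nat \<Rightarrow> (nat \<Rightarrow> nat \<Rightarrow> real) \<Rightarrow> (nat \<Rightarrow> real) \<Rightarrow> real" where
  "quadratic_form n a c = (\<Sum>i<n. \<Sum>j<n. a i j * c i * c j)"

lemma eigensystem_quadratic_form:
  assumes "eigensystem n a d u"
  shows "quadratic_form n a c = (\<Sum>k<n. d k * (\<Sum>i<n. u k i * c i)\<^sup>2)"
proof -
  have "quadratic_form n a c = (\<Sum>i<n. \<Sum>j<n. \<Sum>k<n. d k * ((u k i * c i) * (u k j * c j)))"
    unfolding quadratic_form_def using assms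
    by (intro sum.cong refl) (auto simp: eigensystem_def sum_distrib_right sum_distrib_left mult_ac)
  also have "\<dots> = (\<Sum>i<n. \<Sum>k<n. \<Sum>j<n. d k * ((u k i * c i) * (u k j * c j)))"
    by (intro sum.cong refl sum.swap)
  also have "\<dots> = (\<Sum>k<n. \<Sum>i<n. \<Sum>j<n. d k * ((u k i * c i) * (u k j * c j)))"
    by (rule sum.swap)
  also have "\<dots> = (\<Sum>k<n. d k * (\<Sum>i<n. u k i * c i)\<^sup>2)"
    unfolding power2_eq_square sum_product by (simp only: sum_distrib_left)
  finally show ?thesis .
qed

lemma eigensystem_uminus:
  "eigensystem n a d u \<Longrightarrow> eigensystem n (\<lambda>i j. - a i j) (\<lambda>k. - d k) u"
  by (auto simp: eigensystem_def sum_negf)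

text \<open>
  The eigenvectors with negative eigenvalue span a space on which the form is negative definite. If its
  dimension exceeded the number of linear conditions, then it would contain a nonzero vector satisfying
  all of them.
\<close>
lemma card_negative_le:
  assumes es: "eigensystem n a d u" and J: "finite J"
    and form: "\<And>c. \<forall>j\<in>J. (\<Sum>i<n. w j i * c i) = 0 \<Longrightarrow> 0 \<le> quadratic_form n a c"
  shows "card {k. k < n \<and> d k < 0} \<le> card J"
proof (rule ccontr)
  define N where "N = {k. k < n \<and> d k < 0}"
  have N: "finite N" by (simp add: N_def)
  assume "\<not> ?thesis"
  then have "card J < card N" by (simp add: N_def)
  then obtain b where b: "\<exists>k\<in>N. b k \<noteq> 0" "\<forall>j\<in>J. (\<Sum>k\<in>N. (\<Sum>i<n. w j i * u k i) * b k) = 0"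
    using homogeneous_system_nontrivial_solution[OF J N, of "\<lambda>j k. \<Sum>i<n. w j i * u k i"] by auto
  define c where "c i = (\<Sum>k\<in>N. b k * u k i)" for i
  have lin: "(\<Sum>i<n. v i * c i) = (\<Sum>k\<in>N. (\<Sum>i<n. v i * u k i) * b k)" for v
    unfolding c_def sum_distrib_left sum_distrib_right by (subst sum.swap) (simp add: mult_ac)
  have coord: "(\<Sum>i<n. u l i * c i) = (if l \<in> N then b l else 0)" if "l < n" for l
  proof -
    have "(\<Sum>i<n. u l i * c i) = (\<Sum>k\<in>N. if k = l then b l else 0)"
      unfolding lin using es that by (intro sum.cong) (auto simp: eigensystem_def N_def)
    then show ?thesis using N by simp
  qed
  have "quadratic_form n a c = (\<Sum>k<n. if k \<in> N then d k * (b k)\<^sup>2 else 0)"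
    unfolding eigensystem_quadratic_form[OF es] using coord by (intro sum.cong) auto
  also have "\<dots> = (\<Sum>k\<in>N. d k * (b k)\<^sup>2)"
    by (rule sum.mono_neutral_cong_right) (auto simp: N_def)
  also have "\<dots> < 0"
  proof -
    obtain k where "k \<in> N" "b k \<noteq> 0" using b by auto
    then have "0 < (\<Sum>k\<in>N. - (d k * (b k)\<^sup>2))"
      using N by (intro sum_pos2[of N k]) (auto simp: N_def mult_less_0_iff mult_le_0_iff)
    then show ?thesis by (simp add: sum_negf)
  qed
  finally show False using form[of c] b(2) lin by auto
qed

lemma card_positive_le:
  assumes es: "eigensystem n a d u" and J: "finite J"
    and form: "\<And>c. \<forall>j\<in>J. (\<Sum>i<n. w j i * c i) = 0 \<Longrightarrow> quadratic_form n a c \<le> 0"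
  shows "card {k. k < n \<and> 0 < d k} \<le> card J"
proof -
  have "0 \<le> quadratic_form n (\<lambda>i j. - a i j) c" if "\<forall>j\<in>J. (\<Sum>i<n. w j i * c i) = 0" for c
    using form[OF that] by (simp add: quadratic_form_def sum_negf)
  from card_negative_le[OF eigensystem_uminus[OF es] J this] show ?thesis by simp
qed

text \<open>
  One direction of Cauchy interlacing: extending a vector by zeros does not change the value of the form,
  and the form is nonnegative on vectors orthogonal to all eigenvectors with negative eigenvalue.
\<close>
lemma card_negative_principal_submatrix:
  assumes es: "eigensystem n a d u" and es': "eigensystem m a d' u'" and "m \<le> n"
  shows "card {k. k < m \<and> d' k < 0} \<le> card {k. k < n \<and> d k < 0}"
proof (rule card_negative_le[OF es'])
  fix c assume c: "\<forall>k\<in>{k. k < n \<and> d k < 0}. (\<Sum>i<m. u k i * c i) = 0"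
  define c' where "c' i = (if i < m then c i else 0)" for i
  have ext: "(\<Sum>i<n. f i * c' i) = (\<Sum>i<m. f i * c i)" for f
    using \<open>m \<le> n\<close> by (intro sum.mono_neutral_cong_right) (auto simp: c'_def)
  have "quadratic_form n a c' = (\<Sum>i<n. (\<Sum>j<n. a i j * c' j) * c' i)"
    by (simp add: quadratic_form_def sum_distrib_left mult_ac)
  also have "\<dots> = quadratic_form m a c"
    unfolding ext by (simp add: quadratic_form_def sum_distrib_left mult_ac)
  finally have "quadratic_form m a c = (\<Sum>k<n. d k * (\<Sum>i<m. u k i * c i)\<^sup>2)"
    unfolding eigensystem_quadratic_form[OF es] ext by simp
  also have "0 \<le> \<dots>"
  proof (rule sum_nonneg)
    fix k assume "k \<in> {..<n}"
    then show "0 \<le> d k * (\<Sum>i<m. u k i * c i)\<^sup>2"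
      using c by (cases "d k < 0") auto
  qed
  finally show "0 \<le> quadratic_form m a c" .
qed simp

lemma card_positive_principal_submatrix:
  assumes "eigensystem n a d u" "eigensystem m a d' u'" "m \<le> n"
  shows "card {k. k < m \<and> 0 < d' k} \<le> card {k. k < n \<and> 0 < d k}"
  using card_negative_principal_submatrix[OF eigensystem_uminus[OF assms(1)] eigensystem_uminus[OF assms(2)] assms(3)]
  by simp

lemma card_sign_split:
  fixes d :: "nat \<Rightarrow> real"
  shows "card {k. k < n \<and> 0 < d k} + card {k. k < n \<and> d k = 0} + card {k. k < n \<and> d k < 0} = n"
proof -
  have "{..<n} = {k. k < n \<and> 0 < d k} \<union> {k. k < n \<and> d k = 0} \<union> {k. k < n \<and> d k < 0}" by auto
  then have "n = card ({k. k < n \<and> 0 < d k} \<union> {k. k < n \<and> d k = 0} \<union> {k. k < n \<and> d k < 0})"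
    by (metis card_lessThan)
  also have "\<dots> = card ({k. k < n \<and> 0 < d k} \<union> {k. k < n \<and> d k = 0}) + card {k. k < n \<and> d k < 0}"
    by (rule card_Un_disjoint) auto
  also have "card ({k. k < n \<and> 0 < d k} \<union> {k. k < n \<and> d k = 0}) = card {k. k < n \<and> 0 < d k} + card {k. k < n \<and> d k = 0}"
    by (rule card_Un_disjoint) auto
  finally show ?thesis by simp
qed

lemma eigensystem_nonsingular_split:
  assumes "eigensystem n a d u" "det (mat n n (\<lambda>(i,j). a i j)) \<noteq> 0"
  shows "card {k. k < n \<and> d k = 0} = 0" "card {k. k < n \<and> 0 < d k} + card {k. k < n \<and> d k < 0} = n"
proof -
  show "card {k. k < n \<and> d k = 0} = 0"
    using assms(2) unfolding eigensystem_det[OF assms(1)] by auto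
  then show "card {k. k < n \<and> 0 < d k} + card {k. k < n \<and> d k < 0} = n"
    using card_sign_split[of n d] by linarith
qed

lemma sgn_prod_card_negative:
  fixes d :: "nat \<Rightarrow> real"
  assumes "(\<Prod>k<n. d k) \<noteq> 0"
  shows "0 < (- 1) ^ card {k. k < n \<and> d k < 0} * (\<Prod>k<n. d k)"
  using assms
proof (induction n)
  case (Suc n)
  have "{k. k < Suc n \<and> d k < 0} = (if d n < 0 then insert n {k. k < n \<and> d k < 0} else {k. k < n \<and> d k < 0})"
    by (auto simp: less_Suc_eq)
  moreover have "0 < (- 1) ^ card {k. k < n \<and> d k < 0} * (\<Prod>k<n. d k)" "d n \<noteq> 0"
    using Suc by auto
  ultimately show ?case
    by (cases "d n < 0") (auto simp: mult_less_0_iff zero_less_mult_iff)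
qed simp

lemma continuous_on_det:
  fixes a :: "real \<Rightarrow> nat \<Rightarrow> nat \<Rightarrow> real"
  assumes "\<And>i j. i < n \<Longrightarrow> j < n \<Longrightarrow> continuous_on S (\<lambda>t. a t i j)"
  shows "continuous_on S (\<lambda>t. det (mat n n (\<lambda>(i,j). a t i j)))"
proof -
  have "det (mat n n (\<lambda>(i,j). a t i j)) = (\<Sum>p\<in>{p. p permutes {0..<n}}. signof p * (\<Prod>i=0..<n. a t i (p i)))" for t
    by (subst det_def'[of _ n]) (auto intro!: sum.cong prod.cong dest: permutes_in_image)
  moreover have "continuous_on S (\<lambda>t. \<Sum>p\<in>{p. p permutes {0..<n}}. signof p * (\<Prod>i=0..<n. a t i (p i)))"
    using assms by (intro continuous_intros) (auto dest: permutes_in_image)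
  ultimately show ?thesis by simp
qed

text \<open>
  If all leading principal minors stay nonzero along a continuous path of symmetric matrices, then the
  inertia does not change. By interlacing, bordering a matrix increases the number of negative eigenvalues by
  0 or 1; which of the two happens is decided by the sign of the determinant, which is constant along the
  path by the intermediate value theorem.
\<close>
lemma card_negative_constant:
  fixes a :: "real \<Rightarrow> nat \<Rightarrow> nat \<Rightarrow> real"
  assumes "\<alpha> \<le> \<beta>"
    and sym: "\<And>t i j. t \<in> {\<alpha>..\<beta>} \<Longrightarrow> a t i j = a t j i"
    and cont: "\<And>i j. i < n \<Longrightarrow> j < n \<Longrightarrow> continuous_on {\<alpha>..\<beta>} (\<lambda>t. a t i j)"
    and det: "\<And>t m. t \<in> {\<alpha>..\<beta>} \<Longrightarrow> m \<le> n \<Longrightarrow> det (mat m m (\<lambda>(i,j). a t i j)) \<noteq> 0"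
    and es: "eigensystem n (a \<alpha>) d u" "eigensystem n (a \<beta>) d' u'"
  shows "card {k. k < n \<and> d k < 0} = card {k. k < n \<and> d' k < 0}"
  using cont det es
proof (induction n arbitrary: d u d' u')
  case 0
  then show ?case by simp
next
  case (Suc n)
  obtain e v where ev: "eigensystem n (a \<alpha>) e v"
    using symmetric_eigensystem[of n "a \<alpha>"] sym assms(1) by auto
  obtain e' v' where ev': "eigensystem n (a \<beta>) e' v'"
    using symmetric_eigensystem[of n "a \<beta>"] sym assms(1) by auto
  have IH: "card {k. k < n \<and> e k < 0} = card {k. k < n \<and> e' k < 0}"
    using Suc.IH[OF _ _ ev ev'] Suc.prems(1,2) by simp
  have step: "card {k. k < Suc n \<and> x k < 0} = card {k. k < n \<and> y k < 0} \<or>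
      card {k. k < Suc n \<and> x k < 0} = Suc (card {k. k < n \<and> y k < 0})"
    if x: "eigensystem (Suc n) (a t) x z" and y: "eigensystem n (a t) y z'" and t: "t \<in> {\<alpha>..\<beta>}" for x y z z' t
  proof -
    have "card {k. k < Suc n \<and> 0 < x k} + card {k. k < Suc n \<and> x k < 0} = Suc n"
      using eigensystem_nonsingular_split(2)[OF x] Suc.prems(2)[OF t, of "Suc n"] by simp
    moreover have "card {k. k < n \<and> 0 < y k} + card {k. k < n \<and> y k < 0} = n"
      using eigensystem_nonsingular_split(2)[OF y] Suc.prems(2)[OF t, of n] by simp
    moreover have "card {k. k < n \<and> y k < 0} \<le> card {k. k < Suc n \<and> x k < 0}"
      using card_negative_principal_submatrix[OF x y] by simp
    moreover have "card {k. k < n \<and> 0 < y k} \<le> card {k. k < Suc n \<and> 0 < x k}"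
      using card_positive_principal_submatrix[OF x y] by simp
    ultimately show ?thesis by linarith
  qed
  define D where "D t = det (mat (Suc n) (Suc n) (\<lambda>(i,j). a t i j))" for t
  have D: "D \<alpha> = (\<Prod>k<Suc n. d k)" "D \<beta> = (\<Prod>k<Suc n. d' k)"
    unfolding D_def using eigensystem_det Suc.prems(3,4) by blast+
  have Dnz: "D t \<noteq> 0" if "t \<in> {\<alpha>..\<beta>}" for t
    unfolding D_def using Suc.prems(2)[OF that] by simp
  have "0 < D \<alpha> * D \<beta>"
    using Suc.prems(1) Dnz assms(1) unfolding D_def
    by (intro nonvanishing_continuous_same_sign continuous_on_det) auto
  moreover have "0 < (- 1) ^ card {k. k < Suc n \<and> d k < 0} * D \<alpha>"
    "0 < (- 1) ^ card {k. k < Suc n \<and> d' k < 0} * D \<beta>"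
    using sgn_prod_card_negative[where n = "Suc n" and d = d] sgn_prod_card_negative[where n = "Suc n" and d = d'] Dnz[of \<alpha>] Dnz[of \<beta>] assms(1) D
    by simp_all
  ultimately have "even (card {k. k < Suc n \<and> d k < 0}) = even (card {k. k < Suc n \<and> d' k < 0})"
    by (auto simp: zero_less_mult_iff minus_one_power_iff split: if_splits)
  moreover have "\<alpha> \<in> {\<alpha>..\<beta>}" "\<beta> \<in> {\<alpha>..\<beta>}" using assms(1) by auto
  ultimately show ?case
    using step[OF Suc.prems(3) ev] step[OF Suc.prems(4) ev'] IH by auto
qed

section \<open>Sign counts of Loewner matrices\<close>

text \<open>
  The recursion that lowers the exponent by two. The two extra terms have the form \<open>v x + v y\<close>, hence they
  contribute nothing to the quadratic form of a vector whose entries sum to zero.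
\<close>
lemma loewner_kernel_shift:
  assumes "0 < x" "0 < y"
  shows "loewner_kernel r x y = x * y * loewner_kernel (r - 2) x y + x powr (r - 1) + y powr (r - 1)"
proof -
  have 1: "t powr r = t * t * t powr (r - 2)" "t powr (r - 1) = t * t powr (r - 2)"
    "t powr (r - 2) = t * t powr (r - 2 - 1)" if "0 < t" for t
    using that by (simp_all add: powr_diff powr_numeral power2_eq_square power3_eq_cube)
  show ?thesis
  proof (cases "x = y")
    case True
    have "r * x powr (r - 1) = x * x * ((r - 2) * x powr (r - 2 - 1)) + 2 * x powr (r - 1)"
      unfolding 1(2)[OF assms(1)] 1(3)[OF assms(1)] by (simp add: algebra_simps)
    then show ?thesis using True by (simp add: loewner_kernel_def)
  next
    case False
    then show ?thesis unfolding loewner_kernel_def 1(1,2)[OF assms(1)] 1(1,2)[OF assms(2)]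
      by (simp add: field_simps)
  qed
qed

lemma loewner_kernel_uminus:
  assumes "0 < x" "0 < y"
  shows "loewner_kernel (- s) x y = - (x powr (- s) * y powr (- s) * loewner_kernel s x y)"
proof (cases "x = y")
  case True
  have "x powr (- s - 1) = x powr (- s) * x powr (- s) * x powr (s - 1)"
    by (simp flip: powr_add)
  then show ?thesis using True by (simp add: loewner_kernel_def)
next
  case False
  then show ?thesis using assms by (simp add: loewner_kernel_def powr_minus field_simps)
qed

abbreviation loewner_form :: "nat \<Rightarrow> (nat \<Rightarrow> real) \<Rightarrow> real \<Rightarrow> (nat \<Rightarrow> real) \<Rightarrow> real" where
  "loewner_form n p r \<equiv> quadratic_form n (\<lambda>i j. loewner_kernel r (p i) (p j))"

lemma loewner_eigensystem: "\<exists>d u. eigensystem n (\<lambda>i j. loewner_kernel r (p i) (p j)) d u"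
  by (rule symmetric_eigensystem) (rule loewner_kernel_commute)

text \<open>
  Iterating the recursion: each step uses that the sum of the current vector vanishes and multiplies the
  vector entrywise by \<open>p\<close>, so \<open>k\<close> steps need the first \<open>k\<close> moments of \<open>c\<close> to vanish.
\<close>
lemma loewner_form_shift:
  assumes p: "\<And>i. i < n \<Longrightarrow> 0 < p i"
    and "\<And>l. l < k \<Longrightarrow> (\<Sum>i<n. p i ^ l * c i) = 0"
  shows "loewner_form n p r c = loewner_form n p (r - 2 * real k) (\<lambda>i. p i ^ k * c i)"
  using assms(2)
proof (induction k arbitrary: r c)
  case (Suc k)
  define c' where "c' i = p i * c i" for i
  have zero: "(\<Sum>i<n. c i) = 0" using Suc.prems[of 0] by simp
  have "loewner_form n p r c = (\<Sum>i<n. \<Sum>j<n. loewner_kernel (r - 2) (p i) (p j) * c' i * c' j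
      + (p i powr (r - 1) * c i * c j + c i * (p j powr (r - 1) * c j)))"
    unfolding quadratic_form_def c'_def using p
    by (intro sum.cong refl) (subst loewner_kernel_shift, auto simp: algebra_simps)
  also have "\<dots> = loewner_form n p (r - 2) c' + ((\<Sum>i<n. p i powr (r - 1) * c i) * (\<Sum>j<n. c j)
      + (\<Sum>i<n. c i) * (\<Sum>j<n. p j powr (r - 1) * c j))"
    unfolding sum_product quadratic_form_def by (simp only: sum.distrib mult.assoc)
  also have "\<dots> = loewner_form n p (r - 2) c'" using zero by simp
  also have "\<dots> = loewner_form n p (r - 2 - 2 * real k) (\<lambda>i. p i ^ k * c' i)"
    using Suc.prems[of "Suc l" for l] by (intro Suc.IH) (auto simp: c'_def mult_ac)
  finally show ?case by (simp add: c'_def algebra_simps)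
qed simp

text \<open>
  Positive semidefiniteness of the Cauchy matrix. Subtracting a suitable rank one form removes the last row
  and column and leaves, up to a diagonal congruence by the factors \<open>g i\<close>, the Cauchy matrix of the remaining
  points.
\<close>
lemma cauchy_form_nonneg:
  fixes u c :: "nat \<Rightarrow> real"
  assumes "\<And>i. i < n \<Longrightarrow> 0 < u i"
  shows "0 \<le> quadratic_form n (\<lambda>i j. 1 / (u i + u j)) c"
  using assms
proof (induction n arbitrary: c)
  case 0
  then show ?case by (simp add: quadratic_form_def)
next
  case (Suc n)
  define w where "w = u n"
  define g where "g i = (u i - w) / (u i + w)" for i
  define c' where "c' i = g i * c i" for i
  have pos: "0 < w" "0 < u i" if "i < Suc n" for i using Suc.prems that by (auto simp: w_def)
  \<comment> \<open>The Schur complement of the last entry \<open>1 / (2 * w)\<close>; note that \<open>g n = 0\<close>.\<close>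
  have split: "1 / (u i + u j) = 2 * w / ((u i + w) * (u j + w)) + g i * g j * (1 / (u i + u j))"
    if "i < Suc n" "j < Suc n" for i j
  proof -
    have "u i + u j \<noteq> 0" "u i + w \<noteq> 0" "u j + w \<noteq> 0" using pos[OF that(1)] pos[OF that(2)] by linarith+
    then show ?thesis unfolding g_def by (simp add: divide_simps) (simp add: algebra_simps)
  qed
  have "quadratic_form (Suc n) (\<lambda>i j. 1 / (u i + u j)) c =
      (\<Sum>i<Suc n. \<Sum>j<Suc n. 2 * w * ((c i / (u i + w)) * (c j / (u j + w))) + 1 / (u i + u j) * c' i * c' j)"
    unfolding quadratic_form_def c'_def
    by (intro sum.cong refl) (subst split, auto simp: algebra_simps)
  also have "\<dots> = 2 * w * (\<Sum>i<Suc n. c i / (u i + w))\<^sup>2 + quadratic_form (Suc n) (\<lambda>i j. 1 / (u i + u j)) c'"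
    unfolding power2_eq_square sum_product quadratic_form_def by (simp only: sum.distrib sum_distrib_left)
  also have "quadratic_form (Suc n) (\<lambda>i j. 1 / (u i + u j)) c' = quadratic_form n (\<lambda>i j. 1 / (u i + u j)) c'"
    by (simp add: quadratic_form_def c'_def g_def w_def)
  finally show ?case using Suc.IH[of c'] Suc.prems pos[of 0] by simp
qed

lemma loewner_kernel_half:
  assumes "0 < x" "0 < y"
  shows "loewner_kernel (1/2) x y = 1 / (sqrt x + sqrt y)"
proof (cases "x = y")
  case True
  have "x powr (1/2 - 1) = 1 / sqrt x"
    using assms by (simp add: powr_minus_divide powr_half_sqrt[symmetric] flip: minus_divide_left)
  then show ?thesis using True by (simp add: loewner_kernel_def)
next
  case False
  have "x - y = (sqrt x - sqrt y) * (sqrt x + sqrt y)" using assms by (simp add: algebra_simps)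
  moreover have "sqrt x \<noteq> sqrt y" "sqrt x + sqrt y \<noteq> 0" using False assms by (auto simp: add_nonneg_eq_0_iff)
  ultimately show ?thesis using False assms by (simp add: loewner_kernel_def powr_half_sqrt)
qed

lemma loewner_det_nonzero:
  assumes p: "\<And>i. i < n \<Longrightarrow> 0 < p i" "inj_on p {..<n}" and r: "r \<in> \<int> \<Longrightarrow> real n \<le> \<bar>r\<bar>"
  shows "det (mat n n (\<lambda>(i,j). loewner_kernel r (p i) (p j))) \<noteq> 0"
proof
  let ?A = "mat n n (\<lambda>(i,j). loewner_kernel r (p i) (p j))"
  assume "det ?A = 0"
  then obtain v where v: "v \<in> carrier_vec n" "v \<noteq> 0\<^sub>v n" "?A *\<^sub>v v = 0\<^sub>v n"
    using det_0_iff_vec_prod_zero_field[of ?A n] by auto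
  define Y where "Y = p ` {..<n}"
  define c where "c y = v $ the_inv_into {..<n} p y" for y
  have c: "c (p i) = v $ i" if "i < n" for i
    using that p(2) by (simp add: c_def the_inv_into_f_f)
  have "\<forall>y\<in>Y. c y = 0"
  proof (rule loewner_combination_zero[of Y r Y c "{}"])
    show "real (card Y) \<le> \<bar>r\<bar>" if "r \<in> \<int>" using r[OF that] p(2) by (simp add: Y_def card_image)
    show "(\<Sum>y\<in>Y. c y * loewner_kernel r z y) = 0" if "z \<in> Y" for z
    proof -
      obtain i where i: "z = p i" "i < n" using \<open>z \<in> Y\<close> by (auto simp: Y_def)
      have "(\<Sum>y\<in>Y. c y * loewner_kernel r z y) = (\<Sum>j<n. v $ j * loewner_kernel r (p i) (p j))"
        unfolding Y_def using p(2) c i by (simp add: sum.reindex)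
      also have "\<dots> = (?A *\<^sub>v v) $ i"
        using i v(1) by (simp add: scalar_prod_def atLeast0LessThan mult.commute)
      finally show ?thesis using v(3) i by simp
    qed
  qed (use p in \<open>auto simp: Y_def\<close>)
  then have "v $ i = 0" if "i < n" for i using c[OF that] that by (auto simp: Y_def)
  then show False using v(1,2) by auto
qed

text \<open>
  A path between two exponents that avoids the integers of absolute value below \<open>n\<close> meets only nonsingular
  matrices, for all sizes up to \<open>n\<close>.
\<close>
lemma loewner_card_negative_constant:
  assumes p: "\<And>i. i < n \<Longrightarrow> 0 < p i" "inj_on p {..<n}"
    and nonint: "\<And>t. min r s \<le> t \<Longrightarrow> t \<le> max r s \<Longrightarrow> t \<in> \<int> \<Longrightarrow> real n \<le> \<bar>t\<bar>"
    and es: "eigensystem n (\<lambda>i j. loewner_kernel r (p i) (p j)) d u"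
      "eigensystem n (\<lambda>i j. loewner_kernel s (p i) (p j)) d' u'"
  shows "card {k. k < n \<and> d k < 0} = card {k. k < n \<and> d' k < 0}"
proof -
  have main: "card {k. k < n \<and> d k < 0} = card {k. k < n \<and> d' k < 0}"
    if "r \<le> s" and nonint: "\<And>t. r \<le> t \<Longrightarrow> t \<le> s \<Longrightarrow> t \<in> \<int> \<Longrightarrow> real n \<le> \<bar>t\<bar>"
      and es: "eigensystem n (\<lambda>i j. loewner_kernel r (p i) (p j)) d u"
      "eigensystem n (\<lambda>i j. loewner_kernel s (p i) (p j)) d' u'" for r s d u d' u'
  proof (rule card_negative_constant[OF \<open>r \<le> s\<close> _ _ _ es])
    show "continuous_on {r..s} (\<lambda>t. loewner_kernel t (p i) (p j))" if "i < n" "j < n" for i j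
      using p(1)[OF that(1)] p(1)[OF that(2)]
      by (cases "p i = p j") (auto simp: loewner_kernel_def intro!: continuous_intros)
    show "det (mat m m (\<lambda>(i, j). loewner_kernel t (p i) (p j))) \<noteq> 0" if "t \<in> {r..s}" "m \<le> n" for t m
      using p that nonint[of t] by (intro loewner_det_nonzero) (auto intro: inj_on_subset)
  qed (rule loewner_kernel_commute)
  show ?thesis
  proof (cases "r \<le> s")
    case True
    then show ?thesis using main[OF True _ es] nonint by simp
  next
    case False
    then show ?thesis using main[OF _ _ es(2,1)] nonint by simp
  qed
qed

text \<open>
  Loewner's theorem for powers. At exponent 1/2 the matrix is a Cauchy matrix in the square roots of the
  points, and no eigenvalue can become negative while the exponent moves inside \<open>{0<..<1}\<close>.
\<close>
lemma loewner_form_nonneg: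
  assumes p: "\<And>i. i < n \<Longrightarrow> 0 < p i" "inj_on p {..<n}" and s: "0 \<le> s" "s \<le> 1"
  shows "0 \<le> loewner_form n p s c"
proof -
  consider "s = 0" | "s = 1" | "0 < s" "s < 1" using s by linarith
  then show ?thesis
  proof cases
    case 1
    have "loewner_kernel 0 (p i) (p j) = 0" if "i < n" "j < n" for i j
      using p(1)[OF that(1)] p(1)[OF that(2)] by (simp add: loewner_kernel_def)
    then show ?thesis using 1 by (simp add: quadratic_form_def)
  next
    case 2
    have "loewner_kernel 1 (p i) (p j) = 1" if "i < n" "j < n" for i j
      using p(1)[OF that(1)] p(1)[OF that(2)] by (simp add: loewner_kernel_def)
    then have "loewner_form n p s c = (\<Sum>i<n. \<Sum>j<n. c i * c j)"
      unfolding quadratic_form_def 2 by (intro sum.cong refl) simp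
    also have "\<dots> = (\<Sum>i<n. c i)\<^sup>2" by (simp add: power2_eq_square sum_product)
    finally show ?thesis by simp
  next
    case 3
    obtain d u where d: "eigensystem n (\<lambda>i j. loewner_kernel s (p i) (p j)) d u"
      using loewner_eigensystem by blast
    obtain e v where e: "eigensystem n (\<lambda>i j. loewner_kernel (1/2) (p i) (p j)) e v"
      using loewner_eigensystem by blast
    have "0 \<le> loewner_form n p (1/2) c" for c
    proof -
      have "loewner_form n p (1/2) c = quadratic_form n (\<lambda>i j. 1 / (sqrt (p i) + sqrt (p j))) c"
        unfolding quadratic_form_def using p(1) by (intro sum.cong refl) (auto simp: loewner_kernel_half)
      then show ?thesis using cauchy_form_nonneg[of n "\<lambda>i. sqrt (p i)" c] p(1) by simp
    qed
    then have "card {k. k < n \<and> e k < 0} \<le> card ({} :: nat set)"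
      by (intro card_negative_le[OF e]) auto
    moreover have "t \<notin> \<int>" if "min s (1/2) \<le> t" "t \<le> max s (1/2)" for t
    proof -
      have "0 < t" "t < 1" using that 3 by linarith+
      then show ?thesis by (auto elim!: Ints_cases)
    qed
    then have "card {k. k < n \<and> d k < 0} = card {k. k < n \<and> e k < 0}"
      by (intro loewner_card_negative_constant[OF p _ d e]) auto
    ultimately have "card {k. k < n \<and> d k < 0} = 0" by (simp only: card.empty le_zero_eq)
    then have "{k. k < n \<and> d k < 0} = {}" by (subst (asm) card_0_eq) simp_all
    then have "0 \<le> d k" if "k < n" for k using that by (metis (mono_tags, lifting) empty_iff mem_Collect_eq not_le)
    then show ?thesis unfolding eigensystem_quadratic_form[OF d] by (intro sum_nonneg) auto
  qed
qed

lemma loewner_form_nonpos: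
  assumes p: "\<And>i. i < n \<Longrightarrow> 0 < p i" "inj_on p {..<n}" and s: "- 1 \<le> s" "s \<le> 0"
  shows "loewner_form n p s c \<le> 0"
proof -
  have "loewner_form n p s c = - loewner_form n p (- s) (\<lambda>i. p i powr s * c i)"
    unfolding quadratic_form_def sum_negf[symmetric] using p(1)
    by (intro sum.cong refl) (auto simp: loewner_kernel_uminus[of _ _ "- s", simplified] mult_ac)
  then show ?thesis using loewner_form_nonneg[OF p, of "- s"] s by simp
qed

lemma loewner_card_negative_le:
  assumes p: "\<And>i. i < n \<Longrightarrow> 0 < p i" "inj_on p {..<n}"
    and r: "2 * real k \<le> r" "r \<le> 2 * real k + 1"
    and es: "eigensystem n (\<lambda>i j. loewner_kernel r (p i) (p j)) d u"
  shows "card {l. l < n \<and> d l < 0} \<le> k"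
proof -
  have "card {l. l < n \<and> d l < 0} \<le> card {..<k}"
  proof (rule card_negative_le[OF es])
    fix c assume "\<forall>l\<in>{..<k}. (\<Sum>i<n. p i ^ l * c i) = 0"
    then have "loewner_form n p r c = loewner_form n p (r - 2 * real k) (\<lambda>i. p i ^ k * c i)"
      by (intro loewner_form_shift p) auto
    then show "0 \<le> loewner_form n p r c" using loewner_form_nonneg[OF p] r by simp
  qed simp
  then show ?thesis by simp
qed

lemma loewner_card_positive_le:
  assumes p: "\<And>i. i < n \<Longrightarrow> 0 < p i" "inj_on p {..<n}"
    and r: "2 * real k - 1 \<le> r" "r \<le> 2 * real k"
    and es: "eigensystem n (\<lambda>i j. loewner_kernel r (p i) (p j)) d u"
  shows "card {l. l < n \<and> 0 < d l} \<le> k"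
proof -
  have "card {l. l < n \<and> 0 < d l} \<le> card {..<k}"
  proof (rule card_positive_le[OF es])
    fix c assume "\<forall>l\<in>{..<k}. (\<Sum>i<n. p i ^ l * c i) = 0"
    then have "loewner_form n p r c = loewner_form n p (r - 2 * real k) (\<lambda>i. p i ^ k * c i)"
      by (intro loewner_form_shift p) auto
    then show "loewner_form n p r c \<le> 0" using loewner_form_nonpos[OF p] r by simp
  qed simp
  then show ?thesis by simp
qed

lemma Ints_greater_pred_imp_ge:
  fixes t :: real assumes "t \<in> \<int>" "real n - 1 < t" shows "real n \<le> t"
proof -
  obtain z :: int where z: "t = of_int z" using assms(1) by (rule Ints_cases)
  then have "real_of_int (int n - 1) < real_of_int z" using assms(2) by simp
  then have "int n \<le> z" unfolding of_int_less_iff by simp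
  then have "real_of_int (int n) \<le> real_of_int z" unfolding of_int_le_iff .
  then show ?thesis using z by simp
qed

lemma loewner_card_negative_large_exponent:
  assumes p: "\<And>i. i < n \<Longrightarrow> 0 < p i" "inj_on p {..<n}" and r: "real n - 1 < r" "real n - 1 < s" "0 < r" "0 < s"
    and es: "eigensystem n (\<lambda>i j. loewner_kernel r (p i) (p j)) d u"
      "eigensystem n (\<lambda>i j. loewner_kernel s (p i) (p j)) d' u'"
  shows "card {k. k < n \<and> d k < 0} = card {k. k < n \<and> d' k < 0}"
proof (rule loewner_card_negative_constant[OF p _ es])
  fix t assume "min r s \<le> t" "t \<le> max r s" "t \<in> \<int>"
  moreover from this have "real n - 1 < t" using r(1,2) by linarith
  ultimately have "real n \<le> t" by (intro Ints_greater_pred_imp_ge)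
  then show "real n \<le> \<bar>t\<bar>" by linarith
qed

text \<open>
  For exponent \<open>n\<close> the two upper bounds add up to \<open>n\<close>, and the matrix is nonsingular, so both are attained.
  The exponents greater than \<open>n - 1\<close> form an interval without exceptional integers.
\<close>
lemma loewner_cards_large_exponent:
  assumes p: "\<And>i. i < n \<Longrightarrow> 0 < p i" "inj_on p {..<n}" and r: "real n - 1 < r" "0 < r"
    and es: "eigensystem n (\<lambda>i j. loewner_kernel r (p i) (p j)) d u"
  shows "card {l. l < n \<and> 0 < d l} = Suc n div 2" "card {l. l < n \<and> d l < 0} = n div 2"
proof -
  have "card {l. l < n \<and> 0 < d l} = Suc n div 2 \<and> card {l. l < n \<and> d l < 0} = n div 2"
  proof (cases "n = 0")
    case False
    obtain e v where e: "eigensystem n (\<lambda>i j. loewner_kernel (real n) (p i) (p j)) e v"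
      using loewner_eigensystem by blast
    have "det (mat n n (\<lambda>(i,j). loewner_kernel (real n) (p i) (p j))) \<noteq> 0"
      by (rule loewner_det_nonzero[OF p]) auto
    from eigensystem_nonsingular_split(2)[OF e this]
    have sum_e: "card {l. l < n \<and> 0 < e l} + card {l. l < n \<and> e l < 0} = n" .
    have int: "r \<in> \<int> \<Longrightarrow> real n \<le> \<bar>r\<bar>" using Ints_greater_pred_imp_ge[of r n] r by simp
    have "det (mat n n (\<lambda>(i,j). loewner_kernel r (p i) (p j))) \<noteq> 0"
      by (rule loewner_det_nonzero[OF p int])
    from eigensystem_nonsingular_split(2)[OF es this]
    have sum_d: "card {l. l < n \<and> 0 < d l} + card {l. l < n \<and> d l < 0} = n" .
    have "card {l. l < n \<and> 0 < e l} \<le> Suc n div 2"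
      using loewner_card_positive_le[OF p _ _ e, of "Suc n div 2"] by (cases "even n") (auto elim!: evenE oddE)
    moreover have "card {l. l < n \<and> e l < 0} \<le> n div 2"
      using loewner_card_negative_le[OF p _ _ e, of "n div 2"] by (cases "even n") (auto elim!: evenE oddE)
    moreover have "card {l. l < n \<and> d l < 0} = card {l. l < n \<and> e l < 0}"
      using loewner_card_negative_large_exponent[OF p r(1) _ r(2) _ es e] False by simp
    ultimately show ?thesis using sum_e sum_d by linarith
  qed simp
  then show "card {l. l < n \<and> 0 < d l} = Suc n div 2" "card {l. l < n \<and> d l < 0} = n div 2" by auto
qed

text \<open>
  Applied with \<open>m\<close> the integer part of \<open>r\<close>: the leading principal submatrix of size \<open>m\<close> belongs to the range of
  large exponents, where the inertia is known, and interlacing carries its counts over to size \<open>n\<close>.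
\<close>
lemma loewner_cards_ge:
  assumes p: "\<And>i. i < n \<Longrightarrow> 0 < p i" "inj_on p {..<n}" and r: "real m - 1 < r" "0 < r" "m \<le> n"
    and es: "eigensystem n (\<lambda>i j. loewner_kernel r (p i) (p j)) d u"
  shows "Suc m div 2 \<le> card {l. l < n \<and> 0 < d l}" "m div 2 \<le> card {l. l < n \<and> d l < 0}"
proof -
  obtain e v where e: "eigensystem m (\<lambda>i j. loewner_kernel r (p i) (p j)) e v"
    using loewner_eigensystem by blast
  have p': "\<And>i. i < m \<Longrightarrow> 0 < p i" "inj_on p {..<m}"
    using p \<open>m \<le> n\<close> by (auto intro: inj_on_subset)
  show "Suc m div 2 \<le> card {l. l < n \<and> 0 < d l}"
    using card_positive_principal_submatrix[OF es e \<open>m \<le> n\<close>] loewner_cards_large_exponent(1)[OF p' r(1,2) e] by simp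
  show "m div 2 \<le> card {l. l < n \<and> d l < 0}"
    using card_negative_principal_submatrix[OF es e \<open>m \<le> n\<close>] loewner_cards_large_exponent(2)[OF p' r(1,2) e] by simp
qed

section \<open>Simplicity of the nonzero eigenvalues\<close>

text \<open>
  The condition \<open>c 0 = 0\<close> cuts the plane spanned by the two eigenvectors down to dimension at least one.
\<close>
lemma two_eigenvectors_combination:
  assumes es: "eigensystem n a d u" and kl: "k < n" "l < n" "k \<noteq> l" "d k = \<mu>" "d l = \<mu>"
  shows "\<exists>c. c 0 = 0 \<and> (\<exists>i<n. c i \<noteq> 0) \<and> (\<forall>i<n. (\<Sum>j<n. a i j * c j) = \<mu> * c i)"
proof -
  have ev: "(\<Sum>j<n. a i j * u q j) = d q * u q i" if "i < n" "q < n" for i q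
  proof -
    have "(\<Sum>j<n. a i j * u q j) = (\<Sum>j<n. \<Sum>k<n. d k * u k i * (u k j * u q j))"
      using es that by (intro sum.cong refl) (auto simp: eigensystem_def sum_distrib_left mult_ac)
    also have "\<dots> = (\<Sum>k<n. d k * u k i * (\<Sum>j<n. u k j * u q j))"
      by (subst sum.swap) (simp add: sum_distrib_left)
    also have "\<dots> = (\<Sum>k<n. if k = q then d q * u q i else 0)"
      using es that by (intro sum.cong refl) (auto simp: eigensystem_def)
    finally show ?thesis using that by simp
  qed
  have norm: "(\<Sum>i<n. u k i * u k i) = 1" "(\<Sum>i<n. u k i * u l i) = 0"
    using es kl by (auto simp: eigensystem_def)
  show ?thesis
  proof (cases "u k 0 = 0")
    case True
    have "\<exists>i<n. u k i \<noteq> 0" 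
    proof (rule ccontr)
      assume "\<not> ?thesis"
      then have "(\<Sum>i<n. u k i * u k i) = 0" by (intro sum.neutral) auto
      then show False using norm(1) by simp
    qed
    then show ?thesis using True ev[OF _ kl(1)] kl(4) by (intro exI[of _ "u k"]) simp
  next
    case False
    define c where "c i = u l 0 * u k i - u k 0 * u l i" for i
    have ne: "(\<Sum>i<n. c i * u l i) \<noteq> 0"
    proof -
      have "(\<Sum>i<n. c i * u l i) = u l 0 * (\<Sum>i<n. u k i * u l i) - u k 0 * (\<Sum>i<n. u l i * u l i)"
        by (simp add: c_def algebra_simps sum_subtractf sum_distrib_left)
      also have "(\<Sum>i<n. u l i * u l i) = 1" using es kl by (auto simp: eigensystem_def)
      finally show ?thesis using norm False by simp
    qed
    have "\<exists>i<n. c i \<noteq> 0"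
    proof (rule ccontr)
      assume "\<not> ?thesis"
      then have "(\<Sum>i<n. c i * u l i) = 0" by (intro sum.neutral) auto
      then show False using ne by simp
    qed
    moreover have "(\<Sum>j<n. a i j * c j) = \<mu> * c i" if "i < n" for i
    proof -
      have "(\<Sum>j<n. a i j * c j) = u l 0 * (\<Sum>j<n. a i j * u k j) - u k 0 * (\<Sum>j<n. a i j * u l j)"
        by (simp add: c_def algebra_simps sum_subtractf sum_distrib_left)
      then show ?thesis using ev[OF that] kl by (simp add: c_def algebra_simps)
    qed
    ultimately show ?thesis by (intro exI[of _ c]) (auto simp: c_def)
  qed
qed

lemma loewner_nonzero_eigenvalue_simple:
  assumes p: "\<And>i. i < n \<Longrightarrow> 0 < p i" "\<And>i j. i < j \<Longrightarrow> j < n \<Longrightarrow> p i < p j" and "0 < r" "\<mu> \<noteq> 0"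
    and es: "eigensystem n (\<lambda>i j. loewner_kernel r (p i) (p j)) d u"
  shows "card {k. k < n \<and> d k = \<mu>} \<le> 1"
proof (rule ccontr)
  assume "\<not> ?thesis"
  then obtain k l where kl: "k < n" "l < n" "k \<noteq> l" "d k = \<mu>" "d l = \<mu>"
    by (auto simp: not_le card_le_Suc0_iff_eq)
  obtain c where c: "c 0 = 0" "\<exists>i<n. c i \<noteq> 0"
    "\<forall>i<n. (\<Sum>j<n. loewner_kernel r (p i) (p j) * c j) = \<mu> * c i"
    using two_eigenvectors_combination[OF es kl] by blast
  have inj: "inj_on p {..<n}" by (rule linorder_inj_onI) (use p(2) in force)+
  define S where "S = p ` {..<n}"
  define c' where "c' y = c (the_inv_into {..<n} p y)" for y
  have c': "c' (p i) = c i" if "i < n" for i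
    using that inj by (simp add: c'_def the_inv_into_f_f)
  have "Min S = p 0"
  proof (rule Min_eqI)
    show "p 0 \<le> y" if "y \<in> S" for y
    proof -
      obtain i where "y = p i" "i < n" using \<open>y \<in> S\<close> by (auto simp: S_def)
      then show ?thesis using p(2)[of 0 i] by (cases "i = 0") auto
    qed
  qed (use kl(1) in \<open>auto simp: S_def\<close>)
  moreover have "c' (Min S) \<noteq> 0"
  proof (rule eigenvector_first_component_nonzero[OF _ _ \<open>0 < r\<close> \<open>\<mu> \<noteq> 0\<close>])
    show "(\<Sum>y\<in>S. c' y * loewner_kernel r x y) = \<mu> * c' x" if "x \<in> S" for x
    proof -
      obtain i where i: "x = p i" "i < n" using \<open>x \<in> S\<close> by (auto simp: S_def)
      have "(\<Sum>y\<in>S. c' y * loewner_kernel r x y) = (\<Sum>j<n. loewner_kernel r (p i) (p j) * c j)"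
        unfolding S_def using inj c' i by (simp add: sum.reindex mult.commute)
      then show ?thesis using c(3) c' i by simp
    qed
    show "\<exists>y\<in>S. c' y \<noteq> 0" using c(2) c' by (auto simp: S_def)
  qed (use p(1) in \<open>auto simp: S_def\<close>)
  ultimately show False using c(1) c' kl(1) by auto
qed

section \<open>Inertia of Loewner matrices\<close>

lemma strictly_increasing_inj_on:
  fixes p :: "nat \<Rightarrow> real"
  assumes "\<And>i j. i < j \<Longrightarrow> j < n \<Longrightarrow> p i < p j" shows "inj_on p {..<n}"
  by (rule linorder_inj_onI) (use assms in force)+

lemma loewner_powr_eq:
  assumes "\<And>i j. i < j \<Longrightarrow> j < n \<Longrightarrow> p i < p j"
  shows "loewner_powr n p r = mat n n (\<lambda>(i,j). loewner_kernel r (p i) (p j))"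
proof (rule eq_matI)
  have "p i \<noteq> p j" if "i < n" "j < n" "i \<noteq> j" for i j
    using strictly_increasing_inj_on[of n p] assms that by (auto simp: inj_on_def)
  then show "loewner_powr n p r $$ (i, j) = mat n n (\<lambda>(i,j). loewner_kernel r (p i) (p j)) $$ (i, j)"
    if "i < dim_row (mat n n (\<lambda>(i,j). loewner_kernel r (p i) (p j)))"
      "j < dim_col (mat n n (\<lambda>(i,j). loewner_kernel r (p i) (p j)))" for i j
    using that by (auto simp: loewner_powr_def loewner_kernel_def)
qed (auto simp: loewner_powr_def)

lemma invertible_mat_iff_det:
  fixes A :: "real mat" assumes A: "A \<in> carrier_mat n n"
  shows "invertible_mat A \<longleftrightarrow> det A \<noteq> 0"
proof
  assume "invertible_mat A"
  then obtain B where "inverts_mat A B" "inverts_mat B A"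
    unfolding invertible_mat_def by blast
  then have AB: "A * B = 1\<^sub>m n" and BA: "B * A = 1\<^sub>m (dim_row B)"
    using A by (simp_all add: inverts_mat_def)
  have "dim_col B = n" using arg_cong[OF AB, of dim_col] by simp
  moreover have "dim_row B = n" using arg_cong[OF BA, of dim_col] A by simp
  ultimately have B: "B \<in> carrier_mat n n" by auto
  have "det A * det B = 1" using det_mult[OF A B] AB by simp
  then show "det A \<noteq> 0" by auto
next
  assume "det A \<noteq> 0"
  then obtain B where "B \<in> carrier_mat n n" "A * B = 1\<^sub>m n" "B * A = 1\<^sub>m n"
    using det_non_zero_imp_unit[OF A, of "()"] by (auto simp: Units_def ring_mat_def)
  then show "invertible_mat A" using A by (auto simp: invertible_mat_def inverts_mat_def)
qed

context
  fixes n :: nat and p :: "nat \<Rightarrow> real"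
  assumes p: "\<And>i. i < n \<Longrightarrow> 0 < p i" "\<And>i j. i < j \<Longrightarrow> j < n \<Longrightarrow> p i < p j"
begin

lemma loewner_powr_kernel: "loewner_powr n p r = mat n n (\<lambda>(i,j). loewner_kernel r (p i) (p j))"
  using p(2) by (rule loewner_powr_eq)

lemma inj_p: "inj_on p {..<n}" using p(2) by (rule strictly_increasing_inj_on)

lemma inertia_loewner_of_nat:
  assumes m: "1 \<le> m" "m \<le> n"
  shows "inertia (loewner_powr n p (real m)) = (Suc m div 2, n - m, m div 2)"
proof -
  obtain d u where es: "eigensystem n (\<lambda>i j. loewner_kernel (real m) (p i) (p j)) d u"
    using loewner_eigensystem by blast
  have "card {k. k < n \<and> 0 < d k} \<le> Suc m div 2"
    using loewner_card_positive_le[OF p(1) inj_p _ _ es, of "Suc m div 2"] by (cases "even m") (auto elim!: evenE oddE)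
  moreover have "card {k. k < n \<and> d k < 0} \<le> m div 2"
    using loewner_card_negative_le[OF p(1) inj_p _ _ es, of "m div 2"] by (cases "even m") (auto elim!: evenE oddE)
  moreover have "Suc m div 2 \<le> card {k. k < n \<and> 0 < d k}" "m div 2 \<le> card {k. k < n \<and> d k < 0}"
    using loewner_cards_ge[OF p(1) inj_p _ _ m(2) es] m(1) by auto
  ultimately have "card {k. k < n \<and> 0 < d k} = Suc m div 2" "card {k. k < n \<and> d k < 0} = m div 2" by auto
  moreover have "card {k. k < n \<and> d k = 0} = n - m"
    using card_sign_split[of n d] calculation by linarith
  ultimately show ?thesis unfolding loewner_powr_kernel eigensystem_inertia[OF es] by simp
qed

lemma inertia_loewner_nonint:
  assumes r: "0 < r" "r < real n" "r \<notin> \<int>"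
  shows "\<lfloor>r\<rfloor> = 2 * int k \<Longrightarrow> inertia (loewner_powr n p r) = (n - k, 0, k)"
    and "\<lfloor>r\<rfloor> = 2 * int k - 1 \<Longrightarrow> inertia (loewner_powr n p r) = (k, 0, n - k)"
proof -
  obtain d u where es: "eigensystem n (\<lambda>i j. loewner_kernel r (p i) (p j)) d u"
    using loewner_eigensystem by blast
  have "det (mat n n (\<lambda>(i,j). loewner_kernel r (p i) (p j))) \<noteq> 0"
    using r by (intro loewner_det_nonzero[OF p(1) inj_p]) auto
  note split = eigensystem_nonsingular_split[OF es this]
  note inertia = loewner_powr_kernel eigensystem_inertia[OF es]
  { assume fl: "\<lfloor>r\<rfloor> = 2 * int k"
    then have bounds: "2 * real k \<le> r" "r < 2 * real k + 1" by linarith+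
    have "card {l. l < n \<and> d l < 0} \<le> k"
      using loewner_card_negative_le[OF p(1) inj_p _ _ es] bounds by simp
    moreover have "k \<le> card {l. l < n \<and> d l < 0}"
      using loewner_cards_ge(2)[OF p(1) inj_p _ r(1) _ es, of "2 * k"] bounds r(2) by simp
    ultimately show "inertia (loewner_powr n p r) = (n - k, 0, k)"
      using split unfolding inertia by simp }
  { assume fl: "\<lfloor>r\<rfloor> = 2 * int k - 1"
    then have bounds: "2 * real k - 1 \<le> r" "r < 2 * real k" by linarith+
    have k: "k \<ge> 1" using bounds r(1) by (cases k) auto
    have "card {l. l < n \<and> 0 < d l} \<le> k"
      using loewner_card_positive_le[OF p(1) inj_p _ _ es] bounds by simp
    moreover have "k \<le> card {l. l < n \<and> 0 < d l}"
      using loewner_cards_ge(1)[OF p(1) inj_p _ r(1) _ es, of "2 * k - 1"] bounds r(2) k by (simp add: of_nat_diff)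
    ultimately show "inertia (loewner_powr n p r) = (k, 0, n - k)"
      using split unfolding inertia by simp }
qed

lemma inertia_loewner_large_exponent:
  assumes r: "0 < r" "real n - 1 < r"
  shows "inertia (loewner_powr n p r) = (Suc n div 2, 0, n div 2)"
proof -
  obtain d u where es: "eigensystem n (\<lambda>i j. loewner_kernel r (p i) (p j)) d u"
    using loewner_eigensystem by blast
  have "det (mat n n (\<lambda>(i,j). loewner_kernel r (p i) (p j))) \<noteq> 0"
    using Ints_greater_pred_imp_ge[of r n] r by (intro loewner_det_nonzero[OF p(1) inj_p]) auto
  note split = eigensystem_nonsingular_split[OF es this]
  show ?thesis
    using split loewner_cards_large_exponent[OF p(1) inj_p r(2,1) es]
    unfolding loewner_powr_kernel eigensystem_inertia[OF es] by simp
qed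

lemma loewner_singular_iff:
  assumes "0 < r"
  shows "\<not> invertible_mat (loewner_powr n p r) \<longleftrightarrow> r \<in> real ` {1..n - 1}"
proof
  have L: "loewner_powr n p r \<in> carrier_mat n n" by (simp add: loewner_powr_def)
  { assume "\<not> invertible_mat (loewner_powr n p r)"
    then have det: "det (loewner_powr n p r) = 0" using invertible_mat_iff_det[OF L] by simp
    have "\<not> (r \<in> \<int> \<longrightarrow> real n \<le> \<bar>r\<bar>)"
      using loewner_det_nonzero[OF p(1) inj_p, where r = r] det loewner_powr_kernel[of r] by auto
    then have r: "r \<in> \<int>" "r < real n" using \<open>0 < r\<close> by auto
    then obtain z :: int where z: "r = of_int z" by (auto elim: Ints_cases)
    then have "0 < z" "z < int n" using r(2) \<open>0 < r\<close> by auto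
    then have "nat z \<in> {1..n - 1}" "r = real (nat z)" using z by auto
    then show "r \<in> real ` {1..n - 1}" by blast }
  { assume "r \<in> real ` {1..n - 1}"
    then obtain m where m: "r = real m" "1 \<le> m" "m < n" by auto
    have "eig_mult (loewner_powr n p r) 0 = n - m"
      using inertia_loewner_of_nat[of m] m by (simp add: inertia_def)
    then have "eigenvalue (loewner_powr n p r) 0"
      using m(3) L by (auto simp: eig_mult_def eigenvalue_root_char_poly order_root)
    then obtain v where v: "v \<in> carrier_vec n" "v \<noteq> 0\<^sub>v n" "loewner_powr n p r *\<^sub>v v = 0 \<cdot>\<^sub>v v"
      unfolding eigenvalue_def eigenvector_def using L by auto
    moreover have "0 \<cdot>\<^sub>v v = 0\<^sub>v n" using v(1) by auto
    ultimately have "det (loewner_powr n p r) = 0"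
      using det_0_iff_vec_prod_zero_field[OF L] by auto
    then show "\<not> invertible_mat (loewner_powr n p r)" using invertible_mat_iff_det[OF L] by simp }
qed

lemma loewner_eigenvalue_simple:
  assumes "0 < r" "eigenvalue (loewner_powr n p r) x" "x \<noteq> 0"
  shows "eig_mult (loewner_powr n p r) x = 1"
proof -
  obtain d u where es: "eigensystem n (\<lambda>i j. loewner_kernel r (p i) (p j)) d u"
    using loewner_eigensystem by blast
  have "{k. k < n \<and> d k = x} \<noteq> {}"
    using assms(2) unfolding loewner_powr_kernel eigensystem_eigenvalue[OF es] by auto
  then have "0 < card {k. k < n \<and> d k = x}" by (simp add: card_gt_0_iff)
  moreover have "card {k. k < n \<and> d k = x} \<le> 1"
    using loewner_nonzero_eigenvalue_simple[OF p assms(1,3) es] .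
  ultimately show ?thesis
    unfolding loewner_powr_kernel eigensystem_eig_mult[OF es] by simp
qed

end

theorem theorem1p1:
  fixes n :: nat and p :: "nat \<Rightarrow> real" and r :: real
  assumes "n \<ge> 1"
    and "\<And>i. i < n \<Longrightarrow> 0 < p i"
    and "\<And>i j. i < j \<Longrightarrow> j < n \<Longrightarrow> p i < p j"
    and "r > 0"
  shows
    "(\<not> invertible_mat (loewner_powr n p r) \<longleftrightarrow> r \<in> real ` {1..n - 1})
     \<and>
     (\<forall>m\<in>{1..n}. r = real m \<longrightarrow>
        (\<forall>k::nat. m = 2 * k \<longrightarrow> inertia (loewner_powr n p r) = (k, n - m, k)) \<and>
        (\<forall>k::nat. k \<ge> 1 \<and> m = 2 * k - 1 \<longrightarrow> inertia (loewner_powr n p r) = (k, n - m, k - 1)))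
     \<and>
     (r < real n \<and> r \<notin> \<int> \<longrightarrow>
        (\<forall>k::nat. \<lfloor>r\<rfloor> = 2 * int k \<longrightarrow> inertia (loewner_powr n p r) = (n - k, 0, k)) \<and>
        (\<forall>k::nat. \<lfloor>r\<rfloor> = 2 * int k - 1 \<longrightarrow> inertia (loewner_powr n p r) = (k, 0, n - k)))
     \<and>
     (r > real n - 1 \<longrightarrow>
        inertia (loewner_powr n p r) = inertia (loewner_powr n p (real n)))
     \<and>
     (\<forall>x. eigenvalue (loewner_powr n p r) x \<and> x \<noteq> 0 \<longrightarrow> eig_mult (loewner_powr n p r) x = 1)"
proof (intro conjI ballI impI allI)
  have of_nat: "inertia (loewner_powr n p (real m)) = (Suc m div 2, n - m, m div 2)"
    if "m \<in> {1..n}" for m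
    using assms(2,3) by (rule inertia_loewner_of_nat) (use that in \<open>auto\<close>)
  have large: "inertia (loewner_powr n p s) = (Suc n div 2, 0, n div 2)"
    if "0 < s" "real n - 1 < s" for s
    using assms(2,3) that by (rule inertia_loewner_large_exponent)
  show "\<not> invertible_mat (loewner_powr n p r) \<longleftrightarrow> r \<in> real ` {1..n - 1}"
    using assms(2-4) by (rule loewner_singular_iff)
  show "inertia (loewner_powr n p r) = (k, n - m, k)"
    if "m \<in> {1..n}" "r = real m" "m = 2 * k" for m k
    using of_nat[OF that(1)] that(2,3) by simp
  show "inertia (loewner_powr n p r) = (k, n - m, k - 1)"
    if "m \<in> {1..n}" "r = real m" "k \<ge> 1 \<and> m = 2 * k - 1" for m k
  proof -
    have "Suc m div 2 = k" "m div 2 = k - 1" using that(3) by auto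
    then show ?thesis using of_nat[OF that(1)] that(2) by simp
  qed
  show "inertia (loewner_powr n p r) = (n - k, 0, k)"
    if "r < real n \<and> r \<notin> \<int>" "\<lfloor>r\<rfloor> = 2 * int k" for k
    using assms(2,3) by (rule inertia_loewner_nonint(1)) (use assms(4) that in \<open>auto\<close>)
  show "inertia (loewner_powr n p r) = (k, 0, n - k)"
    if "r < real n \<and> r \<notin> \<int>" "\<lfloor>r\<rfloor> = 2 * int k - 1" for k
    using assms(2,3) by (rule inertia_loewner_nonint(2)) (use assms(4) that in \<open>auto\<close>)
  show "inertia (loewner_powr n p r) = inertia (loewner_powr n p (real n))" if "r > real n - 1"
    using large[of r] large[of "real n"] that assms(1,4) by simp
  show "eig_mult (loewner_powr n p r) x = 1" if "eigenvalue (loewner_powr n p r) x \<and> x \<noteq> 0" for x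
    using assms(2,3) by (rule loewner_eigenvalue_simple) (use assms(4) that in \<open>auto\<close>)
qed

end
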